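(* For every finite set of points $P\subseteq\mathbb{R}^2$, there is a memoryless local routing algorithm operating on an overlay network of size $2|P|-2$ (consisting of two trees) achieving the routing ratio of $4\sqrt{26}$.
   Context: Local routing: a finite set $P\subset\mathbb{R}^2$ is preprocessed to build an overlay network $H=(P,E)$, edges having Euclidean length; the size of $H$ is its number of edges (here $H$ is the union of two spanning trees of $P$, so it has at most $2|P|-2$ edges). A routing query from $a\in P$ to $b\in P$ consists of the coordinates of $a$ and $b$ and the coordinates of the neighbors of $a$ in $H$; from this information alone (memoryless: no information is carried from previous steps) the algorithm decides on the next hop $c$, a neighbor of $a$, and the query proceeds recursively from $c$ until $b$ is reached. Convention: in each of the two (rooted) trees the list of neighbors of a vertex is ordered so that the parent comes in the first place, and for the root this place is kept empty. The routing ratio (stretch) of a traversed path from $a$ to $b$ is its length divided by $\|a-b\|$; the routing ratio of the algorithm is the maximum routing ratio over all queries with $a\ne b$. *)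

theory Defs
  imports "HOL-Analysis.Analysis"
begin

type_synonym point = "real ^ 2"

text \<open>
  Undirected simple graphs on a point set are given by their sets of edges \<open>{u, v}\<close>.
  The trees of the entry Graph-Theory are not used: they only exclude directed cycles, so that
  a symmetric digraph with at least one edge is never a tree there.
\<close>

definition graph_on :: "'a set \<Rightarrow> 'a set set \<Rightarrow> bool" where
  "graph_on V E \<longleftrightarrow> (\<forall>e\<in>E. \<exists>u\<in>V. \<exists>v\<in>V. u \<noteq> v \<and> e = {u, v})"

definition neighbors :: "'a set set \<Rightarrow> 'a \<Rightarrow> 'a set" where
  "neighbors E v = {u. {v, u} \<in> E}"

definition walk :: "'a set set \<Rightarrow> 'a \<Rightarrow> 'a list \<Rightarrow> 'a \<Rightarrow> bool" where
  "walk E u xs v \<longleftrightarrow>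
     xs \<noteq> [] \<and> hd xs = u \<and> last xs = v \<and> successively (\<lambda>x y. {x, y} \<in> E) xs"

definition cycle :: "'a set set \<Rightarrow> 'a list \<Rightarrow> bool" where
  "cycle E xs \<longleftrightarrow> length xs \<ge> 3 \<and> distinct xs \<and>
     successively (\<lambda>x y. {x, y} \<in> E) xs \<and> {last xs, hd xs} \<in> E"

definition spanning_tree :: "'a set \<Rightarrow> 'a set set \<Rightarrow> bool" where
  "spanning_tree V E \<longleftrightarrow> graph_on V E \<and>
     (\<forall>u\<in>V. \<forall>v\<in>V. \<exists>xs. walk E u xs v) \<and> (\<nexists>xs. cycle E xs)"

text \<open>The parent is the second vertex of the unique path to the root; the root has none.\<close>

definition parent :: "'a set set \<Rightarrow> 'a \<Rightarrow> 'a \<Rightarrow> 'a option" where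
  "parent E r v = (if v = r then None
     else Some (THE u. \<exists>xs. walk E v (v # u # xs) r \<and> distinct (v # u # xs)))"

text \<open>
  The list of neighbors of a vertex in a rooted tree: the first place holds the parent
  (it is empty, i.e. \<^term>\<open>None\<close>, at the root). The order of the remaining entries, the
  children, is not prescribed and must carry no information, so they are given as a set.
\<close>

type_synonym neighbor_list = "point option \<times> point set"

definition neighbor_list :: "point set set \<Rightarrow> point \<Rightarrow> point \<Rightarrow> neighbor_list" where
  "neighbor_list E r v = (parent E r v, neighbors E v - set_option (parent E r v))"

text \<open>
  A memoryless local routing algorithm on two rooted trees maps the current point, the target
  and the neighbor lists of the current point in the two trees to the next hop. It has no
  access to the point set or to any other part of the network.
\<close>

type_synonym local_algorithm =
  "point \<Rightarrow> point \<Rightarrow> neighbor_list \<Rightarrow> neighbor_list \<Rightarrow> point"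

definition next_hop ::
    "local_algorithm \<Rightarrow> point set set \<Rightarrow> point \<Rightarrow> point set set \<Rightarrow> point \<Rightarrow> point \<Rightarrow> point \<Rightarrow> point" where
  "next_hop A T1 r1 T2 r2 b a = A a b (neighbor_list T1 r1 a) (neighbor_list T2 r2 a)"

text \<open>
  \<open>traverses A T1 r1 T2 r2 b a p\<close>: the query from \<open>a\<close> to \<open>b\<close> reaches \<open>b\<close> after finitely many
  hops, and \<open>p\<close> is the path traversed. Every hop must go along an edge of the union of the trees.
\<close>

inductive traverses ::
    "local_algorithm \<Rightarrow> point set set \<Rightarrow> point \<Rightarrow> point set set \<Rightarrow> point \<Rightarrow> point \<Rightarrow>
     point \<Rightarrow> point list \<Rightarrow> bool"
  for A T1 r1 T2 r2 b where
  arrived: "traverses A T1 r1 T2 r2 b b [b]"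
| hop: "\<lbrakk> a \<noteq> b; c = next_hop A T1 r1 T2 r2 b a; c \<in> neighbors (T1 \<union> T2) a;
          traverses A T1 r1 T2 r2 b c p \<rbrakk> \<Longrightarrow> traverses A T1 r1 T2 r2 b a (a # p)"

definition path_length :: "point list \<Rightarrow> real" where
  "path_length p = (\<Sum>(x, y)\<leftarrow>zip p (tl p). dist x y)"

definition achieves_routing_ratio ::
    "local_algorithm \<Rightarrow> point set \<Rightarrow> point set set \<Rightarrow> point \<Rightarrow> point set set \<Rightarrow> point \<Rightarrow> real \<Rightarrow> bool"
  where
  "achieves_routing_ratio A P T1 r1 T2 r2 t \<longleftrightarrow>
     (\<forall>a\<in>P. \<forall>b\<in>P. a \<noteq> b \<longrightarrow>
       (\<exists>p. traverses A T1 r1 T2 r2 b a p \<and> path_length p / dist a b \<le> t))"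

end

theory Submission
  imports Defs
begin

text \<open>
  Bisecting right isosceles triangles recursively, and colouring the cuts of even and of odd depth
  differently, fills the plane with two fractal trees made of line segments; points of the plane
  are leaves of both. Each tree induces a tree metric that dominates the Euclidean distance. The
  first cut that separates two points has one of the colours, and in the tree of that colour their
  distance is at most \<open>5 \<bar>x\<bar> + \<bar>y\<bar> \<le> sqrt 26 \<parallel>(x, y)\<parallel>\<close>, where \<open>(x, y)\<close> is their difference in
  coordinates adapted to the cut.

  These metrics do not depend on \<open>P\<close>, so the algorithm knows them. The network consists of their
  minimum spanning trees on \<open>P\<close>. In a minimum spanning tree of a tree metric the next vertex
  towards \<open>b\<close> is the unique neighbor that is closer to \<open>b\<close>, so it is found locally. Passing from
  the fractal tree to the spanning tree costs a factor 4: if \<open>c\<close> and \<open>c'\<close> are consecutive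
  vertices, attached to the fractal path to \<open>b\<close> at distance \<open>s\<close> from each other, then \<open>d c c' \<le> 4
  s\<close>, because of any two branchings at distance \<open>s\<close> one has a branch that is no deeper than \<open>s\<close>.
  The same estimate gives a locally computable bound on the remaining length that drops by at
  least the length of every hop; a hop in the tree with the smaller bound therefore decreases the
  minimum of the two bounds as well, and no memory is needed when the trees are switched.
\<close>

subsection \<open>Codes and their tree metric\<close>

text \<open>
  The basic piece of a fractal tree is the diamond with corners 0, 1 and \<open>(1 \<plusminus> \<i>) / 2\<close>, whose axis
  runs from the entry 0 to the exit 1. Its four quadrants are diamonds of half the size whose axes
  all meet in the centre: \<open>QA\<close> (from 0 to the centre) and \<open>QC\<close> (from the centre to 1) cover the
  axis, and \<open>QB\<close>, \<open>QD\<close> branch off to the two sides, with the centre as entry. A point is coded by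
  the quadrants that contain it.
\<close>

datatype quadrant = QA | QB | QC | QD

type_synonym code = "nat \<Rightarrow> quadrant"

definition tail :: "code \<Rightarrow> code" where
  "tail s = (\<lambda>n. s (Suc n))"

text \<open>The path from the entry runs along half of the axis to the centre unless the point is in
  \<open>QA\<close>; the other three quadrants have their entry there. Hence each digit except
  \<open>QA\<close> contributes half of the current axis.\<close>

definition entry_dist :: "code \<Rightarrow> real" where
  "entry_dist s = (\<Sum>n. of_bool (s n \<noteq> QA) * (1/2) ^ Suc n)"

text \<open>Seen from the exit, the roles of \<open>QA\<close> and \<open>QC\<close> are exchanged as long as the code stays on
  the axis; beyond the first branching the distances to both ends change alike.\<close>

definition exit_dist :: "code \<Rightarrow> real" where
  "exit_dist s =
     (\<Sum>n. of_bool (s n \<noteq> (if \<forall>k<n. s k \<in> {QA, QC} then QC else QA)) * (1/2)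
       ^ Suc n)"

lemma summable_binary: "summable (\<lambda>n. of_bool (P n) * (1/2::real) ^ Suc n)"
proof (rule summable_comparison_test')
  show "summable (\<lambda>n. (1/2::real) ^ Suc n)"
    by (simp add: summable_geometric)
qed auto

lemma suminf_binary_bounds:
  "0 \<le> (\<Sum>n. of_bool (P n) * (1/2::real) ^ Suc n)"
  "(\<Sum>n. of_bool (P n) * (1/2::real) ^ Suc n) \<le> 1"
proof -
  show "0 \<le> (\<Sum>n. of_bool (P n) * (1/2::real) ^ Suc n)"
    by (intro suminf_nonneg summable_binary) auto
  have "(\<Sum>n. of_bool (P n) * (1/2::real) ^ Suc n) \<le> (\<Sum>n. (1/2::real) ^ Suc n)"
    by (intro suminf_le summable_binary) (auto simp: summable_geometric)
  also have "\<dots> = 1" using power_half_series sums_unique by fastforce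
  finally show "(\<Sum>n. of_bool (P n) * (1/2::real) ^ Suc n) \<le> 1" .
qed

lemma suminf_binary_split:
  "(\<Sum>n. of_bool (P n) * (1/2::real) ^ Suc n)
     = (of_bool (P 0) + (\<Sum>n. of_bool (P (Suc n)) * (1/2::real) ^ Suc n)) / 2"
proof -
  have "(\<Sum>n. of_bool (P (Suc n)) * (1/2::real) ^ Suc (Suc n)) =
        (\<Sum>n. (of_bool (P (Suc n)) * (1/2::real) ^ Suc n) * (1/2))"
    by (intro suminf_cong) simp
  also have "\<dots> = (\<Sum>n. of_bool (P (Suc n)) * (1/2::real) ^ Suc n) * (1/2)"
    using suminf_mult2[OF summable_binary[of "\<lambda>n. P (Suc n)"], of "1/2"] by simp
  finally show ?thesis
    using suminf_split_head[OF summable_binary[of P]] by simp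
qed

lemma entry_dist_bounds: "0 \<le> entry_dist s" "entry_dist s \<le> 1"
  and exit_dist_bounds: "0 \<le> exit_dist s" "exit_dist s \<le> 1"
  unfolding entry_dist_def exit_dist_def by (rule suminf_binary_bounds)+

lemma entry_dist_rec:
  "entry_dist s = (of_bool (s 0 \<noteq> QA) + entry_dist (tail s)) / 2"
  unfolding entry_dist_def tail_def by (rule suminf_binary_split)

lemma exit_dist_rec:
  "exit_dist s = (case s 0 of QA \<Rightarrow> (1 + exit_dist (tail s)) / 2 | QC \<Rightarrow>
    exit_dist (tail s) / 2
     | _ \<Rightarrow> (1 + entry_dist (tail s)) / 2)"
  unfolding exit_dist_def entry_dist_def tail_def
  by (subst suminf_binary_split) (auto simp: All_less_Suc2 split: quadrant.split)

text \<open>The end that faces the centre is the exit for \<open>QA\<close> and the entry for the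
  other quadrants.\<close>

definition centre_dist :: "code \<Rightarrow> real" where
  "centre_dist s = (if s 0 = QA then exit_dist (tail s) else entry_dist (tail s)) / 2"

text \<open>At the first differing digit the points are in different quadrants of a diamond with
  axis \<open>(1/2) ^ n\<close>, and the path between them passes through its centre.\<close>

definition code_dist :: "code \<Rightarrow> code \<Rightarrow> real" where
  "code_dist s t = (if s = t then 0 else
     let n = LEAST n. s n \<noteq> t n
     in (1/2) ^ n * (centre_dist (\<lambda>k. s (n + k)) + centre_dist (\<lambda>k. t (n + k))))"

lemma tail_eq_iff: "s 0 = t 0 \<Longrightarrow> tail s = tail t \<longleftrightarrow> s = t"
  unfolding tail_def fun_eq_iff by (metis not0_implies_Suc)

lemma code_dist_same: "s 0 = t 0 \<Longrightarrow> code_dist s t = code_dist (tail s) (tail t) / 2"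
proof (cases "s = t")
  case False
  assume eq: "s 0 = t 0"
  from False obtain n where n: "s n \<noteq> t n" by (auto simp: fun_eq_iff)
  have "(LEAST n. s n \<noteq> t n) = Suc (LEAST n. s (Suc n) \<noteq> t (Suc n))"
    using Least_Suc[of "\<lambda>n. s n \<noteq> t n" n] n eq by simp
  then show ?thesis
    using False tail_eq_iff[of s t] eq by (simp add: code_dist_def tail_def Let_def)
qed (simp add: code_dist_def)

lemma code_dist_diff: "s 0 \<noteq> t 0 \<Longrightarrow> code_dist s t = centre_dist s + centre_dist t"
proof -
  assume neq: "s 0 \<noteq> t 0"
  then have "(LEAST n. s n \<noteq> t n) = 0" by (intro Least_equality) auto
  with neq show ?thesis by (auto simp: code_dist_def)
qed

lemma centre_dist_bounds: "0 \<le> centre_dist s" "centre_dist s \<le> 1/2"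
  using entry_dist_bounds[of "tail s"] exit_dist_bounds[of "tail s"]
  by (auto simp: centre_dist_def)

lemma code_dist_refl [simp]: "code_dist s s = 0"
  by (simp add: code_dist_def)

lemma code_dist_commute: "code_dist s t = code_dist t s"
  unfolding code_dist_def by (auto simp: Let_def eq_commute add.commute)

lemma code_dist_bounds: "0 \<le> code_dist s t" "code_dist s t \<le> 1"
proof -
  have "0 \<le> code_dist s t \<and> code_dist s t \<le> 1"
  proof (cases "s = t")
    case False
    define n where "n = (LEAST n. s n \<noteq> t n)"
    let ?y = "centre_dist (\<lambda>k. s (n + k)) + centre_dist (\<lambda>k. t (n + k))"
    have y: "0 \<le> ?y" "?y \<le> 1"
      using centre_dist_bounds[of "\<lambda>k. s (n + k)"] centre_dist_bounds[of "\<lambda>k. t (n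
        + k)"] by auto
    have p: "0 \<le> (1/2::real) ^ n" "(1/2::real) ^ n \<le> 1" by (auto simp: power_le_one)
    have "0 \<le> (1/2) ^ n * ?y \<and> (1/2) ^ n * ?y \<le> 1"
      using y p by (auto intro: mult_le_one)
    then show ?thesis using False by (simp add: code_dist_def n_def Let_def)
  qed simp
  then show "0 \<le> code_dist s t" "code_dist s t \<le> 1" by auto
qed

text \<open>Codes are infinite, so recursive estimates have no base case. They are proved with an error
  term that is halved with every digit.\<close>

lemma le_if_le_add_half_power:
  fixes a b c :: real
  assumes "\<And>n. a \<le> b + c * (1/2) ^ n"
  shows "a \<le> b"
proof (rule LIMSEQ_le_const)
  have "(\<lambda>n. b + c * (1/2) ^ n) \<longlonglongrightarrow> b + c * 0"
    by (intro tendsto_intros LIMSEQ_power_zero) auto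
  then show "(\<lambda>n. b + c * (1/2) ^ n) \<longlonglongrightarrow> b" by simp
qed (use assms in auto)

lemma entry_plus_exit: "1 \<le> entry_dist s + exit_dist s"
proof -
  have "1 \<le> entry_dist s + exit_dist s + 1 * (1/2) ^ n" for n
  proof (induction n arbitrary: s)
    case 0 then show ?case using entry_dist_bounds exit_dist_bounds by (simp add: add_nonneg_nonneg)
  next
    case (Suc n)
    show ?case using Suc[of "tail s"] entry_dist_bounds[of "tail s"]
      by (auto simp: entry_dist_rec[of s] exit_dist_rec[of s] field_simps split: quadrant.split)
  qed
  from le_if_le_add_half_power[OF this] show ?thesis .
qed

text \<open>The corners 0 and 1 are the fixed points of the contractions onto \<open>QA\<close> and
  \<open>QC\<close>, so their codes are constant.\<close>

abbreviation entry_code :: code where "entry_code \<equiv> \<lambda>_. QA"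
abbreviation exit_code :: code where "exit_code \<equiv> \<lambda>_. QC"

lemma tail_const [simp]: "tail (\<lambda>_. q) = (\<lambda>_. q)"
  by (simp add: tail_def)

lemma entry_dist_const: "entry_dist (\<lambda>_. q) = of_bool (q \<noteq> QA)"
  using entry_dist_rec[of "\<lambda>_. q"] by auto

lemma exit_dist_entry_code [simp]: "exit_dist entry_code = 1"
  using exit_dist_rec[of entry_code] by auto

lemma code_dist_entry_code: "code_dist entry_code s = entry_dist s"
proof -
  have *: "\<bar>code_dist entry_code s - entry_dist s\<bar> \<le> 0 + 1 * (1/2) ^ n" for n
  proof (induction n arbitrary: s)
    case 0 show ?case
      using code_dist_bounds[of entry_code s] entry_dist_bounds[of s] by simp
  next
    case (Suc n)
    show ?case
    proof (cases "s 0 = QA")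
      case True
      with Suc[of "tail s"] show ?thesis
        by (simp add: code_dist_same entry_dist_rec[of s] field_simps)
    next
      case False
      then show ?thesis
        by (simp add: code_dist_diff centre_dist_def entry_dist_rec[of s] field_simps)
    qed
  qed
  from le_if_le_add_half_power[OF *] show ?thesis by simp
qed

lemma code_dist_exit_code: "code_dist exit_code s = exit_dist s"
proof -
  have *: "\<bar>code_dist exit_code s - exit_dist s\<bar> \<le> 0 + 1 * (1/2) ^ n" for n
  proof (induction n arbitrary: s)
    case 0 show ?case
      using code_dist_bounds[of exit_code s] exit_dist_bounds[of s] by simp
  next
    case (Suc n)
    show ?case
    proof (cases "s 0 = QC")
      case True
      with Suc[of "tail s"] show ?thesis
        by (simp add: code_dist_same exit_dist_rec[of s] field_simps)
    next
      case False
      then show ?thesis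
        by (auto simp add: code_dist_diff centre_dist_def exit_dist_rec[of s] entry_dist_const
            field_simps split: quadrant.split)
    qed
  qed
  from le_if_le_add_half_power[OF *] show ?thesis by simp
qed

section \<open>Gromov products and the four-point condition\<close>

text \<open>The four-point condition follows from ultrametricity of the Gromov product at the entry.\<close>

definition gromov :: "code \<Rightarrow> code \<Rightarrow> real" where
  "gromov s t = (entry_dist s + entry_dist t - code_dist s t) / 2"

text \<open>The place where the path to the point leaves the axis, measured from the entry; it is
  the Gromov product with the exit.\<close>

definition axis_pos :: "code \<Rightarrow> real" where
  "axis_pos s = (1 + entry_dist s - exit_dist s) / 2"

lemma gromov_commute: "gromov s t = gromov t s"
  by (simp add: gromov_def code_dist_commute add.commute)

lemma gromov_exit_code: "gromov s exit_code = axis_pos s"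
  by (simp add: gromov_def axis_pos_def code_dist_commute[of s] code_dist_exit_code entry_dist_const)

lemma gromov_rec:
  "gromov s t = (if s 0 = t 0 then (of_bool (s 0 \<noteq> QA) + gromov (tail s) (tail t)) / 2
     else if s 0 = QA then axis_pos (tail s) / 2
     else if t 0 = QA then axis_pos (tail t) / 2 else 1 / 2)"
proof (cases "s 0 = t 0")
  case True
  then show ?thesis
    by (auto simp: gromov_def code_dist_same entry_dist_rec[of s] entry_dist_rec[of t] field_simps)
next
  case False
  then show ?thesis
    by (auto simp: gromov_def code_dist_diff centre_dist_def axis_pos_def
        entry_dist_rec[of s] entry_dist_rec[of t] field_simps)
qed

lemma axis_pos_rec:
  "axis_pos s = (case s 0 of QA \<Rightarrow> axis_pos (tail s) / 2 | QC \<Rightarrow> (1 +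
    axis_pos (tail s)) / 2 | _ \<Rightarrow> 1/2)"
  by (auto simp: axis_pos_def entry_dist_rec[of s] exit_dist_rec[of s] field_simps
      split: quadrant.split)

lemma axis_pos_bounds: "0 \<le> axis_pos s" "axis_pos s \<le> 1"
  using entry_dist_bounds[of s] exit_dist_bounds[of s] by (auto simp: axis_pos_def)

lemma gromov_bounds: "0 \<le> gromov s t" "gromov s t \<le> 1"
proof -
  have 1: "0 \<le> gromov s t + 1 * (1/2) ^ n" for n
  proof (induction n arbitrary: s t)
    case 0
    have "-1 \<le> gromov s t"
      using entry_dist_bounds[of s] entry_dist_bounds[of t] code_dist_bounds[of s t]
      unfolding gromov_def by (simp add: field_simps)
    then show ?case by simp
  next
    case (Suc n)
    define e :: real where "e = (1/2) ^ n"
    have "0 \<le> e" by (simp add: e_def)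
    then show ?case
      using Suc[of "tail s" "tail t"] axis_pos_bounds[of "tail s"] axis_pos_bounds[of "tail t"]
      unfolding power_Suc e_def[symmetric] by (auto simp: gromov_rec[of s t] add_divide_distrib)
  qed
  from le_if_le_add_half_power[OF this] show "0 \<le> gromov s t" .
  show "gromov s t \<le> 1"
    using entry_dist_bounds[of s] entry_dist_bounds[of t] code_dist_bounds[of s t]
    by (simp add: gromov_def)
qed

text \<open>This is ultrametricity with \<open>exit_code\<close> as third point. It comes first
  because a point of \<open>QA\<close> sees everything outside \<open>QA\<close> at the exit of
  \<open>QA\<close>.\<close>

lemma axis_pos_gromov: "min (gromov s r) (axis_pos r) \<le> axis_pos s"
proof -
  have "min (gromov s r) (axis_pos r) \<le> axis_pos s + 1 * (1/2) ^ n" for n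
  proof (induction n arbitrary: s r)
    case 0
    show ?case using axis_pos_bounds[of s] axis_pos_bounds[of r] by simp
  next
    case (Suc n)
    define e :: real where "e = (1/2) ^ n"
    have p: "0 \<le> e" by (simp add: e_def)
    show ?case
      using Suc[of "tail s" "tail r"] axis_pos_bounds[of "tail s"] axis_pos_bounds[of "tail r"] p
      unfolding power_Suc e_def[symmetric]
      by (cases "s 0"; cases "r 0")
        (simp_all add: gromov_rec[of s r] axis_pos_rec[of s] axis_pos_rec[of r] min_def
          add_divide_distrib split: if_splits)
  qed
  from le_if_le_add_half_power[OF this] show ?thesis .
qed

lemma gromov_ultrametric: "min (gromov s r) (gromov r t) \<le> gromov s t"
proof -
  have "min (gromov s r) (gromov r t) \<le> gromov s t + 1 * (1/2) ^ n" for n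
  proof (induction n arbitrary: s r t)
    case 0
    show ?case using gromov_bounds[of s r] gromov_bounds[of s t] by simp
  next
    case (Suc n)
    let ?s = "tail s" and ?r = "tail r" and ?t = "tail t"
    define e :: real where "e = (1/2) ^ n"
    have p: "0 \<le> e" by (simp add: e_def)
    have IH: "min (gromov ?s ?r) (gromov ?r ?t) \<le> gromov ?s ?t + e"
      "min (axis_pos ?s) (axis_pos ?t) \<le> gromov ?s ?t + e"
      \<comment> \<open>The second instance covers a middle point outside a quadrant
        \<open>QA\<close> that contains both other points.\<close>
      using Suc[of ?s ?r ?t] Suc[of ?s exit_code ?t]
      by (auto simp: gromov_exit_code gromov_commute[of exit_code] e_def)
    have ap: "min (gromov ?s ?r) (axis_pos ?r) \<le> axis_pos ?s"
       "min (gromov ?r ?t) (axis_pos ?r) \<le> axis_pos ?t"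
      using axis_pos_gromov[of ?s ?r] axis_pos_gromov[of ?t ?r] by (auto simp: gromov_commute)
    note b = axis_pos_bounds[of ?s] axis_pos_bounds[of ?r] axis_pos_bounds[of ?t]
      gromov_bounds[of ?s ?t] gromov_bounds[of ?s ?r] gromov_bounds[of ?r ?t]
    consider "s 0 = t 0" "r 0 = s 0" | "s 0 = t 0" "r 0 \<noteq> s 0" | "s 0 \<noteq> t 0" "r 0 = s 0"
      | "s 0 \<noteq> t 0" "r 0 = t 0" | "s 0 \<noteq> t 0" "r 0 \<noteq> s 0" "r 0 \<noteq> t 0"
        by metis
    then show ?case
      using IH ap b p
      unfolding power_Suc e_def[symmetric]
      by cases (auto simp: gromov_rec[of s r] gromov_rec[of s t] gromov_rec[of r t] min_def
          add_divide_distrib split: if_splits)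
  qed
  from le_if_le_add_half_power[OF this] show ?thesis .
qed

lemma code_dist_four_point:
  "code_dist p q + code_dist r t \<le> max (code_dist p r + code_dist q t) (code_dist p t +
    code_dist q r)"
proof -
  have D: "code_dist u v = entry_dist u + entry_dist v - 2 * gromov u v" for u v
    by (simp add: gromov_def field_simps)
  let ?G = gromov
  have u: "?G x z \<le> ?G x y \<or> ?G z y \<le> ?G x y" for x y z
    using gromov_ultrametric[of x z y] by (simp add: min_le_iff_disj)
  have c: "?G q p = ?G p q" "?G r p = ?G p r" "?G t p = ?G p t" "?G r q = ?G q r" "?G t q = ?G q t"
    "?G t r = ?G r t" by (rule gromov_commute)+
  txt \<open>The two cross terms next to the largest one are dominated by the terms on the left.\<close>
  consider "?G p t \<le> ?G p r" "?G q r \<le> ?G p r" | "?G p r \<le> ?G p t" "?G q t \<le> ?G p t"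
    | "?G p r \<le> ?G q r" "?G q t \<le> ?G q r" | "?G p t \<le> ?G q t" "?G q r \<le> ?G q t" by
      linarith
  then have "?G p r + ?G q t \<le> ?G p q + ?G r t \<or> ?G p t + ?G q r \<le> ?G p q + ?G r t"
  proof cases
    case 1
    with u[where x=p and y=q and z=r] u[where x=r and y=t and z=p]
    show ?thesis unfolding c by linarith
  next
    case 2
    with u[where x=p and y=q and z=t] u[where x=t and y=r and z=p]
    show ?thesis unfolding c by linarith
  next
    case 3
    with u[where x=q and y=p and z=r] u[where x=r and y=t and z=q]
    show ?thesis unfolding c by linarith
  next
    case 4
    with u[where x=q and y=p and z=t] u[where x=t and y=r and z=q]
    show ?thesis unfolding c by linarith
  qed
  then show ?thesis unfolding D le_max_iff_disj by linarith
qed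

subsection \<open>Branchings of the code metric\<close>

lemma entry_dist_centre: "entry_dist s = (if s 0 = QA then entry_dist (tail s) / 2 else 1/2 +
  centre_dist s)"
  by (simp add: entry_dist_rec[of s] centre_dist_def add_divide_distrib)

lemma exit_dist_centre: "exit_dist s = (if s 0 = QC then exit_dist (tail s) / 2 else 1/2 +
  centre_dist s)"
  by (auto simp: exit_dist_rec[of s] centre_dist_def add_divide_distrib split: quadrant.split)

lemma entry_dist_le_centre: "entry_dist s \<le> 1/2 + centre_dist s"
  and exit_dist_le_centre: "exit_dist s \<le> 1/2 + centre_dist s"
  using entry_dist_bounds[of "tail s"] exit_dist_bounds[of "tail s"]
  by (auto simp: entry_dist_centre[of s] exit_dist_centre[of s] centre_dist_def)

text \<open>If the first digits differ, one point, say \<open>p\<close>, is not in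
  \<open>QA\<close>. Then \<open>entry_dist p\<close> is \<open>1/2 + centre_dist p\<close>, and the
  other point is at most 1/2 away from the centre.\<close>

lemma code_dist_le_entry: "code_dist p q \<le> max (entry_dist p) (entry_dist q)"
proof -
  have "code_dist p q \<le> max (entry_dist p) (entry_dist q) + 1 * (1/2) ^ n" for n
  proof (induction n arbitrary: p q)
    case 0 show ?case using code_dist_bounds[of p q] entry_dist_bounds[of p] by auto
  next
    case (Suc n)
    define e :: real where "e = (1/2) ^ n"
    have "0 \<le> e" by (simp add: e_def)
    then show ?case
      using Suc[of "tail p" "tail q"] centre_dist_bounds[of p] centre_dist_bounds[of q]
        code_dist_bounds[of "tail p" "tail q"]
      unfolding power_Suc e_def[symmetric]
      by (cases "p 0 = q 0")
        (auto simp: code_dist_same code_dist_diff entry_dist_centre[of p] entry_dist_centre[of q]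
          max_def)
  qed
  from le_if_le_add_half_power[OF this] show ?thesis .
qed

lemma code_dist_le_exit: "code_dist p q \<le> max (exit_dist p) (exit_dist q)"
proof -
  have "code_dist p q \<le> max (exit_dist p) (exit_dist q) + 1 * (1/2) ^ n" for n
  proof (induction n arbitrary: p q)
    case 0 show ?case using code_dist_bounds[of p q] exit_dist_bounds[of p] by auto
  next
    case (Suc n)
    define e :: real where "e = (1/2) ^ n"
    have "0 \<le> e" by (simp add: e_def)
    then show ?case
      using Suc[of "tail p" "tail q"] centre_dist_bounds[of p] centre_dist_bounds[of q]
        code_dist_bounds[of "tail p" "tail q"]
      unfolding power_Suc e_def[symmetric]
      by (cases "p 0 = q 0")
        (auto simp: code_dist_same code_dist_diff exit_dist_centre[of p] exit_dist_centre[of q] max_def)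
  qed
  from le_if_le_add_half_power[OF this] show ?thesis .
qed

text \<open>The two preceding bounds, applied inside the common quadrant to the end that faces the
  centre.\<close>

lemma code_dist_le_centre:
  "p 0 = q 0 \<Longrightarrow> code_dist p q \<le> centre_dist p \<or> code_dist p q \<le> centre_dist q"
  using code_dist_le_entry[of "tail p" "tail q"] code_dist_le_exit[of "tail p" "tail q"]
    code_dist_same[of p q]
  by (cases "q 0 = QA") (simp_all add: centre_dist_def le_max_iff_disj)

text \<open>A different alternative may hold for each \<open>n\<close>; the minimum of the two
  excesses makes it a single inequality, to which the limit applies.\<close>

lemma disj_le_if_half_power:
  fixes a b c d k :: real
  assumes "\<And>n. a \<le> b + k * (1/2) ^ n \<or> c \<le> d + k * (1/2) ^ n"
  shows "a \<le> b \<or> c \<le> d"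
proof -
  have "min (a - b) (c - d) \<le> 0 + k * (1/2) ^ n" for n
    using assms[of n] by (auto simp: min_le_iff_disj)
  from le_if_le_add_half_power[OF this] show ?thesis
    by (auto simp: min_le_iff_disj)
qed

section \<open>Pendant and inner edges of quartets\<close>

text \<open>
  If \<open>d p q + d r t\<close> is the smallest of the three sums, the tree spanned by the four points has an
  inner edge that separates \<open>p, q\<close> from \<open>r, t\<close>. The inequality \<open>2 * d p q + d r t \<le> d q r + d q t\<close>
  then says that the pendant edge of \<open>p\<close> is at most as long as the inner edge. Some pendant edge
  always is; when the recursion leaves a quadrant, other points are replaced by its entry or exit,
  and pendant edges of these do not count.
\<close>

lemma quartet_pair_against_ends:
  assumes "code_dist u v + 1 < entry_dist u + exit_dist v" "code_dist u v + 1 < exit_dist u +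
    entry_dist v"
  shows "2 * code_dist u v + 1 \<le> entry_dist v + exit_dist v \<or>
         2 * code_dist u v + 1 \<le> entry_dist u + exit_dist u"
proof -
  \<comment> \<open>The assumptions are part of the induction because they have to be handed down to
    the tails. The error 3 covers the case \<open>n = 0\<close>, as all distances are between 0 and
    1.\<close>
  have "code_dist u v + 1 < entry_dist u + exit_dist v \<Longrightarrow> code_dist u v + 1 <
    exit_dist u + entry_dist v \<Longrightarrow>
     2 * code_dist u v + 1 \<le> entry_dist v + exit_dist v + 3 * (1/2) ^ n \<or>
     2 * code_dist u v + 1 \<le> entry_dist u + exit_dist u + 3 * (1/2) ^ n" for n
  proof (induction n arbitrary: u v)
    case 0
    show ?case
      using code_dist_bounds[of u v] entry_dist_bounds[of v] exit_dist_bounds[of v] by auto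
  next
    case (Suc n)
    define e :: real where "e = (1/2) ^ Suc n"
    have e: "0 \<le> e" "(1/2) ^ n = 2 * e" by (simp_all add: e_def)
    note IH = Suc.IH[of "tail u" "tail v", unfolded e(2)]
    note ec = entry_dist_centre[of u] entry_dist_centre[of v] exit_dist_centre[of u]
      exit_dist_centre[of v]
    consider "u 0 = v 0" "u 0 = QA" | "u 0 = v 0" "u 0 = QC" | "u 0 = v 0" "u 0 \<noteq> QA" "u 0
      \<noteq> QC"
      | "u 0 \<noteq> v 0" by blast
    then show ?case
    proof cases
      case 1
      then have eqs: "2 * entry_dist u = entry_dist (tail u)" "2 * entry_dist v = entry_dist (tail v)"
        "2 * exit_dist u = 1 + exit_dist (tail u)" "2 * exit_dist v = 1 + exit_dist (tail v)"
        "2 * code_dist u v = code_dist (tail u) (tail v)"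
        using ec by (simp_all add: centre_dist_def code_dist_same)
      have "code_dist (tail u) (tail v) + 1 < entry_dist (tail u) + exit_dist (tail v)"
        "code_dist (tail u) (tail v) + 1 < exit_dist (tail u) + entry_dist (tail v)"
        using eqs Suc.prems by linarith+
      from IH[OF this] eqs show ?thesis unfolding e_def[symmetric] by argo
    next
      case 2
      then have eqs: "2 * exit_dist u = exit_dist (tail u)" "2 * exit_dist v = exit_dist (tail v)"
        "2 * entry_dist u = 1 + entry_dist (tail u)" "2 * entry_dist v = 1 + entry_dist (tail v)"
        "2 * code_dist u v = code_dist (tail u) (tail v)"
        using ec by (simp_all add: centre_dist_def code_dist_same)
      have "code_dist (tail u) (tail v) + 1 < entry_dist (tail u) + exit_dist (tail v)"
        "code_dist (tail u) (tail v) + 1 < exit_dist (tail u) + entry_dist (tail v)"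
        using eqs Suc.prems by linarith+
      from IH[OF this] eqs show ?thesis unfolding e_def[symmetric] by argo
    next
      case 3
      then have "2 * exit_dist u = 1 + 2 * centre_dist u" "2 * exit_dist v = 1 + 2 * centre_dist v"
        "2 * entry_dist u = 1 + 2 * centre_dist u" "2 * entry_dist v = 1 + 2 * centre_dist v"
        "code_dist u v \<le> centre_dist u \<or> code_dist u v \<le> centre_dist v"
        using ec code_dist_le_centre[of u v] by simp_all
      with Suc.prems e(1) show ?thesis unfolding e_def[symmetric] by argo
    next
      case 4
      from entry_dist_le_centre[of u] exit_dist_le_centre[of v] Suc.prems(1) code_dist_diff[of u v, OF 4]
      show ?thesis by linarith
    qed
  qed
  from disj_le_if_half_power[OF this[OF assms]] show ?thesis .
qed

text \<open>Here the inner edge separates \<open>u\<close> and the entry from \<open>v\<close> and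
  the exit. The two alternatives are about the pendant edges of \<open>u\<close> and of
  \<open>v\<close>.\<close>

lemma quartet_pair_with_ends:
  assumes "entry_dist u + exit_dist v < code_dist u v + 1" "entry_dist u + exit_dist v < exit_dist
    u + entry_dist v"
  shows "2 * entry_dist u + exit_dist v \<le> entry_dist v + 1 \<or>
         2 * exit_dist v + entry_dist u \<le> exit_dist u + 1"
proof -
  have "entry_dist u + exit_dist v < code_dist u v + 1 \<Longrightarrow> entry_dist u + exit_dist v
    < exit_dist u + entry_dist v \<Longrightarrow>
     2 * entry_dist u + exit_dist v \<le> entry_dist v + 1 + 3 * (1/2) ^ n \<or>
     2 * exit_dist v + entry_dist u \<le> exit_dist u + 1 + 3 * (1/2) ^ n" for n
  proof (induction n arbitrary: u v)
    case 0
    show ?case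
      using entry_dist_bounds[of u] entry_dist_bounds[of v] exit_dist_bounds[of v] by auto
  next
    case (Suc n)
    define e :: real where "e = (1/2) ^ Suc n"
    have e: "0 \<le> e" "(1/2) ^ n = 2 * e" by (simp_all add: e_def)
    note IH = Suc.IH[of "tail u" "tail v", unfolded e(2)]
    note ec = entry_dist_centre[of u] entry_dist_centre[of v] exit_dist_centre[of u]
      exit_dist_centre[of v]
    consider "u 0 = v 0" "u 0 = QA" | "u 0 = v 0" "u 0 = QC" | "u 0 = v 0" "u 0 \<noteq> QA" "u 0
      \<noteq> QC"
      | "u 0 \<noteq> v 0" by blast
    then show ?case
    proof cases
      case 1
      then have eqs: "2 * entry_dist u = entry_dist (tail u)" "2 * entry_dist v = entry_dist (tail v)"
        "2 * exit_dist u = 1 + exit_dist (tail u)" "2 * exit_dist v = 1 + exit_dist (tail v)"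
        "2 * code_dist u v = code_dist (tail u) (tail v)"
        using ec by (simp_all add: centre_dist_def code_dist_same)
      have "entry_dist (tail u) + exit_dist (tail v) < code_dist (tail u) (tail v) + 1"
        "entry_dist (tail u) + exit_dist (tail v) < exit_dist (tail u) + entry_dist (tail v)"
        using eqs Suc.prems by linarith+
      from IH[OF this] eqs show ?thesis unfolding e_def[symmetric] by argo
    next
      case 2
      then have eqs: "2 * exit_dist u = exit_dist (tail u)" "2 * exit_dist v = exit_dist (tail v)"
        "2 * entry_dist u = 1 + entry_dist (tail u)" "2 * entry_dist v = 1 + entry_dist (tail v)"
        "2 * code_dist u v = code_dist (tail u) (tail v)"
        using ec by (simp_all add: centre_dist_def code_dist_same)
      have "entry_dist (tail u) + exit_dist (tail v) < code_dist (tail u) (tail v) + 1"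
        "entry_dist (tail u) + exit_dist (tail v) < exit_dist (tail u) + entry_dist (tail v)"
        using eqs Suc.prems by linarith+
      from IH[OF this] eqs show ?thesis unfolding e_def[symmetric] by argo
    next
      case 3
      then have "2 * exit_dist u = 1 + 2 * centre_dist u" "2 * exit_dist v = 1 + 2 * centre_dist v"
        "2 * entry_dist u = 1 + 2 * centre_dist u" "2 * entry_dist v = 1 + 2 * centre_dist v"
        "code_dist u v \<le> centre_dist u \<or> code_dist u v \<le> centre_dist v"
        using ec code_dist_le_centre[of u v] by simp_all
      with Suc.prems e(1) show ?thesis unfolding e_def[symmetric] by argo
    next
      case 4
      \<comment> \<open>If \<open>u\<close> is in \<open>QA\<close> or \<open>v\<close> is in
        \<open>QC\<close>, its distance to its own end is at most 1/2, which gives the claim.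
        Otherwise both pairs are joined through the centre, so the assumed strict separation
        fails.\<close>
      consider "u 0 = QA" "v 0 \<noteq> QA" | "v 0 = QC" "u 0 \<noteq> QC" | "u 0 \<noteq> QA" "v 0
        \<noteq> QC"
        using 4 by fastforce
      then show ?thesis
      proof cases
        case 1
        with ec entry_dist_bounds[of "tail u"] have "entry_dist u \<le> 1/2" "entry_dist v = 1/2 +
          centre_dist v" by auto
        with exit_dist_le_centre[of v] e(1) show ?thesis unfolding e_def[symmetric] by linarith
      next
        case 2
        with ec exit_dist_bounds[of "tail v"] have "exit_dist v \<le> 1/2" "exit_dist u = 1/2 +
          centre_dist u" by auto
        with entry_dist_le_centre[of u] e(1) show ?thesis unfolding e_def[symmetric] by linarith
      next
        case 3
        with ec have "entry_dist u = 1/2 + centre_dist u" "exit_dist v = 1/2 + centre_dist v" by auto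
        with Suc.prems(1) code_dist_diff[of u v, OF 4] show ?thesis by linarith
      qed
    qed
  qed
  from disj_le_if_half_power[OF this[OF assms]] show ?thesis .
qed

lemma disj4_le_if_half_power:
  fixes a b c d a' b' c' d' k :: real
  assumes "\<And>n. a \<le> b + k * (1/2) ^ n \<or> c \<le> d + k * (1/2) ^ n \<or>
    a' \<le> b' + k * (1/2) ^ n \<or> c' \<le> d' + k * (1/2) ^ n"
  shows "a \<le> b \<or> c \<le> d \<or> a' \<le> b' \<or> c' \<le> d'"
proof -
  have "min (min (a - b) (c - d)) (min (a' - b') (c' - d')) \<le> 0 + k * (1/2) ^ n" for n
    using assms[of n] by (auto simp: min_le_iff_disj)
  from le_if_le_add_half_power[OF this] show ?thesis
    by (auto simp: min_le_iff_disj)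
qed

lemma code_dist_le_centre_sum: "code_dist s t \<le> centre_dist s + centre_dist t"
  using code_dist_le_centre[of s t] code_dist_diff[of s t] centre_dist_bounds(1)[of s]
    centre_dist_bounds(1)[of t] by (cases "s 0 = t 0") auto

lemma centre_dist_base:
  "centre_dist s = code_dist (tail s) (if s 0 = QA then exit_code else entry_code) / 2"
  by (simp add: centre_dist_def code_dist_commute[of "tail s"] code_dist_entry_code code_dist_exit_code)

text \<open>The alternative for the pendant edge of the end \<open>t\<close> is absent. If exactly
  \<open>p\<close>, \<open>q\<close>, \<open>r\<close> share a quadrant, \<open>t\<close> is
  replaced by the end of it that faces the centre. If \<open>t\<close> shares a quadrant with just
  two of them, \<open>t\<close> and the replacement of the remaining point are the two ends of it,
  and the two preceding lemmas apply.\<close>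

lemma quartet_with_end:
  assumes t: "t = entry_code \<or> t = exit_code"
    and "code_dist p q + code_dist r t < code_dist p r + code_dist q t"
    and "code_dist p q + code_dist r t < code_dist p t + code_dist q r"
  shows "2 * code_dist p q + code_dist r t \<le> code_dist q r + code_dist q t \<or>
         2 * code_dist p q + code_dist r t \<le> code_dist p r + code_dist p t \<or>
         2 * code_dist r t + code_dist p q \<le> code_dist p t + code_dist q t"
proof -
  have "t = entry_code \<or> t = exit_code \<Longrightarrow> 
    code_dist p q + code_dist r t < code_dist p r + code_dist q t \<Longrightarrow>
    code_dist p q + code_dist r t < code_dist p t + code_dist q r \<Longrightarrow>
    2 * code_dist p q + code_dist r t \<le> code_dist q r + code_dist q t + 3 * (1/2) ^ n \<or>
    2 * code_dist p q + code_dist r t \<le> code_dist p r + code_dist p t + 3 * (1/2) ^ n \<or>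
    2 * code_dist r t + code_dist p q \<le> code_dist p t + code_dist q t + 3 * (1/2) ^ n" for n
  proof (induction n arbitrary: p q r t)
    case 0
    show ?case
      using code_dist_bounds[of p q] code_dist_bounds[of r t] code_dist_bounds[of q r]
        code_dist_bounds[of q t]
      by simp
  next
    case (Suc n)
    define e :: real where "e = (1/2) ^ Suc n"
    have e: "0 \<le> e" and e2: "(1/2) ^ n = 2 * e" by (simp_all add: e_def)
    note IH = Suc.IH[of _ "tail p" "tail q" "tail r", unfolded e2]
    have tt: "tail t = t" using Suc.prems(1) by auto
    have ct: "centre_dist t = 1/2" using Suc.prems(1) by (auto simp: centre_dist_def entry_dist_const)
    consider "p 0 = q 0" "p 0 = r 0" "p 0 = t 0" | "p 0 = q 0" "p 0 = r 0" "p 0 \<noteq> t 0"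
      | "p 0 = q 0" "p 0 = t 0" "p 0 \<noteq> r 0" | "p 0 = r 0" "p 0 = t 0" "p 0 \<noteq> q 0"
      | "q 0 = r 0" "q 0 = t 0" "p 0 \<noteq> q 0"
      | "\<not> (p 0 = q 0 \<and> p 0 = r 0)" "\<not> (p 0 = q 0 \<and> p 0 = t 0)" "\<not> (p 0 =
        r 0 \<and> p 0 = t 0)"
        "\<not> (q 0 = r 0 \<and> q 0 = t 0)" by metis
    then show ?case
    proof cases
      case 1
      then have "q 0 = r 0" "q 0 = t 0" "r 0 = t 0" by auto
      with 1 have "2 * code_dist p q = code_dist (tail p) (tail q)" "2 * code_dist p r = code_dist
        (tail p) (tail r)"
        "2 * code_dist p t = code_dist (tail p) t" "2 * code_dist q r = code_dist (tail q) (tail r)"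
        "2 * code_dist q t = code_dist (tail q) t" "2 * code_dist r t = code_dist (tail r) t"
        using tt by (simp_all add: code_dist_same)
      note eqs = this
      have "code_dist (tail p) (tail q) + code_dist (tail r) t < code_dist (tail p) (tail r) +
        code_dist (tail q) t"
        "code_dist (tail p) (tail q) + code_dist (tail r) t < code_dist (tail p) t + code_dist
          (tail q) (tail r)"
        using eqs Suc.prems(2,3) by linarith+
      from IH[OF Suc.prems(1) this] eqs show ?thesis
        unfolding e_def[symmetric] by argo
    next
      case 2
      let ?t = "if p 0 = QA then exit_code else entry_code"
      from 2 have eq: "q 0 = p 0" "r 0 = p 0" "p 0 \<noteq> t 0" by auto
      have "?t = entry_code \<or> ?t = exit_code" by auto
      note IH' = IH[of ?t, OF this]
      have "2 * code_dist p q = code_dist (tail p) (tail q)" "2 * code_dist p r = code_dist (tail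
        p) (tail r)"
        "2 * code_dist q r = code_dist (tail q) (tail r)"
        "2 * code_dist p t = code_dist (tail p) ?t + 1" "2 * code_dist q t = code_dist (tail q) ?t + 1"
        "2 * code_dist r t = code_dist (tail r) ?t + 1"
        using eq ct by (simp_all add: code_dist_same code_dist_diff centre_dist_base[of p]
          centre_dist_base[of q]
            centre_dist_base[of r])
      note eqs = this
      have "code_dist (tail p) (tail q) + code_dist (tail r) ?t < code_dist (tail p) (tail r) +
        code_dist (tail q) ?t"
        "code_dist (tail p) (tail q) + code_dist (tail r) ?t < code_dist (tail p) ?t + code_dist
          (tail q) (tail r)"
        using eqs Suc.prems(2,3) by linarith+
      from IH'[OF this] eqs show ?thesis
        unfolding e_def[symmetric] by argo
    next
      case 3
      then have eq: "p 0 = t 0" "q 0 = t 0" "r 0 \<noteq> t 0" "t 0 \<noteq> r 0" by auto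
      from Suc.prems(1) show ?thesis
      proof
        assume t: "t = entry_code"
        have eqs: "2 * code_dist p q = code_dist (tail p) (tail q)"
          "2 * code_dist p t = entry_dist (tail p)"
          "2 * code_dist q t = entry_dist (tail q)"
          "2 * code_dist p r = exit_dist (tail p) + 2 * centre_dist r"
          "2 * code_dist q r = exit_dist (tail q) + 2 * centre_dist r"
          "2 * code_dist r t = 1 + 2 * centre_dist r"
          using eq t ct by (simp_all add: code_dist_same code_dist_diff centre_dist_def
            code_dist_commute[of _ "\<lambda>_. _"]
              code_dist_entry_code code_dist_exit_code entry_dist_centre[of p] entry_dist_centre[of q]
              entry_dist_centre[of r] exit_dist_centre[of p] exit_dist_centre[of q]
                exit_dist_centre[of r]
              code_dist_commute[of "tail r" "tail p"] code_dist_commute[of "tail r" "tail q"])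
        have "code_dist (tail p) (tail q) + 1 < entry_dist (tail p) + exit_dist (tail q)"
          "code_dist (tail p) (tail q) + 1 < exit_dist (tail p) + entry_dist (tail q)"
          using eqs Suc.prems(2,3) by linarith+
        from quartet_pair_against_ends[OF this] eqs e show ?thesis unfolding e_def[symmetric] by argo
      next
        assume t: "t = exit_code"
        have eqs: "2 * code_dist p q = code_dist (tail p) (tail q)"
          "2 * code_dist p t = exit_dist (tail p)"
          "2 * code_dist q t = exit_dist (tail q)"
          "2 * code_dist p r = entry_dist (tail p) + 2 * centre_dist r"
          "2 * code_dist q r = entry_dist (tail q) + 2 * centre_dist r"
          "2 * code_dist r t = 1 + 2 * centre_dist r"
          using eq t ct by (simp_all add: code_dist_same code_dist_diff centre_dist_def
            code_dist_commute[of _ "\<lambda>_. _"]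
              code_dist_entry_code code_dist_exit_code entry_dist_centre[of p] entry_dist_centre[of q]
              entry_dist_centre[of r] exit_dist_centre[of p] exit_dist_centre[of q]
                exit_dist_centre[of r]
              code_dist_commute[of "tail r" "tail p"] code_dist_commute[of "tail r" "tail q"])
        have "code_dist (tail p) (tail q) + 1 < entry_dist (tail p) + exit_dist (tail q)"
          "code_dist (tail p) (tail q) + 1 < exit_dist (tail p) + entry_dist (tail q)"
          using eqs Suc.prems(2,3) by linarith+
        from quartet_pair_against_ends[OF this] eqs e show ?thesis unfolding e_def[symmetric] by argo
      qed
    next
      case 4
      then have eq: "p 0 = t 0" "r 0 = t 0" "q 0 \<noteq> t 0" "t 0 \<noteq> q 0" by auto
      from Suc.prems(1) show ?thesis
      proof
        assume t: "t = entry_code"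
        have eqs: "2 * code_dist p r = code_dist (tail r) (tail p)"
          "2 * code_dist p t = entry_dist (tail p)"
          "2 * code_dist r t = entry_dist (tail r)"
          "2 * code_dist p q = exit_dist (tail p) + 2 * centre_dist q"
          "2 * code_dist q r = exit_dist (tail r) + 2 * centre_dist q"
          "2 * code_dist q t = 1 + 2 * centre_dist q"
          using eq t ct by (simp_all add: code_dist_same code_dist_diff centre_dist_def
            code_dist_commute[of _ "\<lambda>_. _"]
              code_dist_entry_code code_dist_exit_code entry_dist_centre[of p] entry_dist_centre[of q]
              entry_dist_centre[of r] exit_dist_centre[of p] exit_dist_centre[of q]
                exit_dist_centre[of r]
              code_dist_commute[of "tail r" "tail p"] code_dist_commute[of "tail r" "tail q"])
        have "entry_dist (tail r) + exit_dist (tail p) < code_dist (tail r) (tail p) + 1"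
          "entry_dist (tail r) + exit_dist (tail p) < exit_dist (tail r) + entry_dist (tail p)"
          using eqs Suc.prems(2,3) by linarith+
        from quartet_pair_with_ends[OF this] eqs e show ?thesis unfolding e_def[symmetric] by argo
      next
        assume t: "t = exit_code"
        have eqs: "2 * code_dist p r = code_dist (tail p) (tail r)"
          "2 * code_dist p t = exit_dist (tail p)"
          "2 * code_dist r t = exit_dist (tail r)"
          "2 * code_dist p q = entry_dist (tail p) + 2 * centre_dist q"
          "2 * code_dist q r = entry_dist (tail r) + 2 * centre_dist q"
          "2 * code_dist q t = 1 + 2 * centre_dist q"
          using eq t ct by (simp_all add: code_dist_same code_dist_diff centre_dist_def
            code_dist_commute[of _ "\<lambda>_. _"]
              code_dist_entry_code code_dist_exit_code entry_dist_centre[of p] entry_dist_centre[of q]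
              entry_dist_centre[of r] exit_dist_centre[of p] exit_dist_centre[of q]
                exit_dist_centre[of r]
              code_dist_commute[of "tail r" "tail p"] code_dist_commute[of "tail r" "tail q"])
        have "entry_dist (tail p) + exit_dist (tail r) < code_dist (tail p) (tail r) + 1"
          "entry_dist (tail p) + exit_dist (tail r) < exit_dist (tail p) + entry_dist (tail r)"
          using eqs Suc.prems(2,3) by linarith+
        from quartet_pair_with_ends[OF this] eqs e show ?thesis unfolding e_def[symmetric] by argo
      qed
    next
      case 5
      then have eq: "q 0 = t 0" "r 0 = t 0" "p 0 \<noteq> t 0" "t 0 \<noteq> p 0" by auto
      from Suc.prems(1) show ?thesis
      proof
        assume t: "t = entry_code"
        have eqs: "2 * code_dist q r = code_dist (tail r) (tail q)"
          "2 * code_dist q t = entry_dist (tail q)"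
          "2 * code_dist r t = entry_dist (tail r)"
          "2 * code_dist p q = exit_dist (tail q) + 2 * centre_dist p"
          "2 * code_dist p r = exit_dist (tail r) + 2 * centre_dist p"
          "2 * code_dist p t = 1 + 2 * centre_dist p"
          using eq t ct by (simp_all add: code_dist_same code_dist_diff centre_dist_def
            code_dist_commute[of _ "\<lambda>_. _"]
              code_dist_entry_code code_dist_exit_code entry_dist_centre[of p] entry_dist_centre[of q]
              entry_dist_centre[of r] exit_dist_centre[of p] exit_dist_centre[of q]
                exit_dist_centre[of r]
              code_dist_commute[of "tail r" "tail p"] code_dist_commute[of "tail r" "tail q"])
        have "entry_dist (tail r) + exit_dist (tail q) < code_dist (tail r) (tail q) + 1"
          "entry_dist (tail r) + exit_dist (tail q) < exit_dist (tail r) + entry_dist (tail q)"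
          using eqs Suc.prems(2,3) by linarith+
        from quartet_pair_with_ends[OF this] eqs e show ?thesis unfolding e_def[symmetric] by argo
      next
        assume t: "t = exit_code"
        have eqs: "2 * code_dist q r = code_dist (tail q) (tail r)"
          "2 * code_dist q t = exit_dist (tail q)"
          "2 * code_dist r t = exit_dist (tail r)"
          "2 * code_dist p q = entry_dist (tail q) + 2 * centre_dist p"
          "2 * code_dist p r = entry_dist (tail r) + 2 * centre_dist p"
          "2 * code_dist p t = 1 + 2 * centre_dist p"
          using eq t ct by (simp_all add: code_dist_same code_dist_diff centre_dist_def
            code_dist_commute[of _ "\<lambda>_. _"]
              code_dist_entry_code code_dist_exit_code entry_dist_centre[of p] entry_dist_centre[of q]
              entry_dist_centre[of r] exit_dist_centre[of p] exit_dist_centre[of q]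
                exit_dist_centre[of r]
              code_dist_commute[of "tail r" "tail p"] code_dist_commute[of "tail r" "tail q"])
        have "entry_dist (tail q) + exit_dist (tail r) < code_dist (tail q) (tail r) + 1"
          "entry_dist (tail q) + exit_dist (tail r) < exit_dist (tail q) + entry_dist (tail r)"
          using eqs Suc.prems(2,3) by linarith+
        from quartet_pair_with_ends[OF this] eqs e show ?thesis unfolding e_def[symmetric] by argo
      qed
    next
      case 6
      have "p 0 = q 0 \<or> r 0 = t 0"
      proof (rule ccontr)
        assume "\<not> (p 0 = q 0 \<or> r 0 = t 0)"
        with code_dist_diff[of p q] code_dist_diff[of r t] Suc.prems(2)
          code_dist_le_centre_sum[of p r] code_dist_le_centre_sum[of q t]
        show False by linarith
      qed
      then show ?thesis
      proof
        assume pq: "p 0 = q 0"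
        with 6 have "p 0 \<noteq> r 0" "p 0 \<noteq> t 0" "q 0 \<noteq> r 0" "q 0 \<noteq> t 0" by auto
        then have eqs: "code_dist p r = centre_dist p + centre_dist r" "code_dist p t = centre_dist
          p + centre_dist t"
          "code_dist q r = centre_dist q + centre_dist r" "code_dist q t = centre_dist q + centre_dist t"
          by (simp_all add: code_dist_diff)
        from code_dist_le_centre[of p q, OF pq] eqs code_dist_le_centre_sum[of r t] e show ?thesis
          unfolding e_def[symmetric] by argo
      next
        assume rt: "r 0 = t 0"
        with 6 have "p 0 \<noteq> r 0" "p 0 \<noteq> t 0" "q 0 \<noteq> r 0" "q 0 \<noteq> t 0" by auto
        then have eqs: "code_dist p r = centre_dist p + centre_dist r" "code_dist p t = centre_dist
          p + centre_dist t"
          "code_dist q r = centre_dist q + centre_dist r" "code_dist q t = centre_dist q + centre_dist t"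
          by (simp_all add: code_dist_diff)
        \<comment> \<open>No point is farther from the centre than \<open>t\<close>, so both
          outcomes give the bound by \<open>centre_dist t\<close>, which concerns the pendant edge
          of \<open>r\<close>.\<close>
        from code_dist_le_centre[of r t, OF rt] ct centre_dist_bounds(2)[of r] have "code_dist r t
          \<le> centre_dist t" by linarith
        with eqs code_dist_le_centre_sum[of p q] e show ?thesis unfolding e_def[symmetric] by argo
      qed
    qed
  qed
  \<comment> \<open>The third alternative is repeated to fill the fourth place.\<close>
  from disj4_le_if_half_power[of "2 * code_dist p q + code_dist r t" "code_dist q r + code_dist q t" 3
      "2 * code_dist p q + code_dist r t" "code_dist p r + code_dist p t"
      "2 * code_dist r t + code_dist p q" "code_dist p t + code_dist q t"
      "2 * code_dist r t + code_dist p q" "code_dist p t + code_dist q t"] this[OF assms]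
  show ?thesis by blast
qed

text \<open>As long as all points share a quadrant, the recursion descends. Once exactly three share
  one, the remaining point is replaced by an end and \<open>quartet_with_end\<close> applies with
  roles permuted; otherwise the centre separates the pairs.\<close>

lemma quartet_code:
  assumes "code_dist p q + code_dist r t < code_dist p r + code_dist q t"
    and "code_dist p q + code_dist r t < code_dist p t + code_dist q r"
  shows "2 * code_dist p q + code_dist r t \<le> code_dist q r + code_dist q t \<or>
         2 * code_dist p q + code_dist r t \<le> code_dist p r + code_dist p t \<or>
         2 * code_dist r t + code_dist p q \<le> code_dist p t + code_dist q t \<or>
         2 * code_dist r t + code_dist p q \<le> code_dist p r + code_dist q r"
proof -
  have "code_dist p q + code_dist r t < code_dist p r + code_dist q t \<Longrightarrow>
    code_dist p q + code_dist r t < code_dist p t + code_dist q r \<Longrightarrow>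
    2 * code_dist p q + code_dist r t \<le> code_dist q r + code_dist q t + 3 * (1/2) ^ n \<or>
    2 * code_dist p q + code_dist r t \<le> code_dist p r + code_dist p t + 3 * (1/2) ^ n \<or>
    2 * code_dist r t + code_dist p q \<le> code_dist p t + code_dist q t + 3 * (1/2) ^ n \<or>
    2 * code_dist r t + code_dist p q \<le> code_dist p r + code_dist q r + 3 * (1/2) ^ n" for n
  proof (induction n arbitrary: p q r t)
    case 0
    show ?case
      using code_dist_bounds[of p q] code_dist_bounds[of r t] code_dist_bounds[of q r]
        code_dist_bounds[of q t]
      by simp
  next
    case (Suc n)
    define e :: real where "e = (1/2) ^ Suc n"
    have e: "0 \<le> e" and e2: "(1/2) ^ n = 2 * e" by (simp_all add: e_def)
    note IH = Suc.IH[of "tail p" "tail q" "tail r" "tail t", unfolded e2]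
    let ?b = "\<lambda>s. if s 0 = QA then exit_code else entry_code"
    consider "p 0 = q 0" "p 0 = r 0" "p 0 = t 0" | "p 0 = q 0" "p 0 = r 0" "p 0 \<noteq> t 0"
      | "p 0 = q 0" "p 0 = t 0" "p 0 \<noteq> r 0" | "p 0 = r 0" "p 0 = t 0" "p 0 \<noteq> q 0"
      | "q 0 = r 0" "q 0 = t 0" "p 0 \<noteq> q 0"
      | "\<not> (p 0 = q 0 \<and> p 0 = r 0)" "\<not> (p 0 = q 0 \<and> p 0 = t 0)" "\<not> (p 0 =
        r 0 \<and> p 0 = t 0)"
        "\<not> (q 0 = r 0 \<and> q 0 = t 0)" by metis
    then show ?case
    proof cases
      case 1
      then have "q 0 = r 0" "q 0 = t 0" "r 0 = t 0" by auto
      with 1 have "2 * code_dist p q = code_dist (tail p) (tail q)" "2 * code_dist p r = code_dist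
        (tail p) (tail r)"
        "2 * code_dist p t = code_dist (tail p) (tail t)" "2 * code_dist q r = code_dist (tail q)
          (tail r)"
        "2 * code_dist q t = code_dist (tail q) (tail t)" "2 * code_dist r t = code_dist (tail r)
          (tail t)"
        by (simp_all add: code_dist_same)
      note eqs = this
      have "code_dist (tail p) (tail q) + code_dist (tail r) (tail t) < code_dist (tail p) (tail r)
        + code_dist (tail q) (tail t)"
        "code_dist (tail p) (tail q) + code_dist (tail r) (tail t) < code_dist (tail p) (tail t) +
          code_dist (tail q) (tail r)"
        using eqs Suc.prems by linarith+
      from IH[OF this] eqs show ?thesis
        unfolding e_def[symmetric] by argo
    next
      case 2
      then have eq: "q 0 = p 0" "r 0 = p 0" "p 0 \<noteq> t 0" by auto
      \<comment> \<open>From inside the quadrant, \<open>t\<close> lies behind the end facing the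
        centre. Moving it there changes only its own pendant edge.\<close>
      define base where "base = ?b p"
      have base: "base = entry_code \<or> base = exit_code" by (simp add: base_def)
      have eqs: "2 * code_dist p q = code_dist (tail p) (tail q)"
        "2 * code_dist p r = code_dist (tail p) (tail r)"
        "2 * code_dist q r = code_dist (tail q) (tail r)"
        "2 * code_dist p t = code_dist (tail p) base + 2 * centre_dist t"
        "2 * code_dist q t = code_dist (tail q) base + 2 * centre_dist t"
        "2 * code_dist r t = code_dist (tail r) base + 2 * centre_dist t"
        using eq by (simp_all add: code_dist_same code_dist_diff base_def centre_dist_base[of p]
          centre_dist_base[of q] centre_dist_base[of r])
      note c = code_dist_commute[of "tail p" "tail r"] code_dist_commute[of "tail q" "tail r"]
      have "code_dist (tail p) (tail q) + code_dist (tail r) base < code_dist (tail p) (tail r) +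
        code_dist (tail q) base"
        "code_dist (tail p) (tail q) + code_dist (tail r) base < code_dist (tail p) base +
          code_dist (tail q) (tail r)"
        using eqs c Suc.prems by linarith+
      from quartet_with_end[OF base this] eqs c e show ?thesis unfolding e_def[symmetric] by argo
    next
      case 3
      then have eq: "q 0 = p 0" "t 0 = p 0" "p 0 \<noteq> r 0" "r 0 \<noteq> p 0" by auto
      define base where "base = ?b p"
      have base: "base = entry_code \<or> base = exit_code" by (simp add: base_def)
      have eqs: "2 * code_dist p q = code_dist (tail p) (tail q)"
        "2 * code_dist p t = code_dist (tail p) (tail t)"
        "2 * code_dist q t = code_dist (tail q) (tail t)"
        "2 * code_dist p r = code_dist (tail p) base + 2 * centre_dist r"
        "2 * code_dist q r = code_dist (tail q) base + 2 * centre_dist r"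
        "2 * code_dist r t = code_dist (tail t) base + 2 * centre_dist r"
        using eq by (simp_all add: code_dist_same code_dist_diff base_def centre_dist_base[of p]
          centre_dist_base[of q] centre_dist_base[of t])
      note c = code_dist_commute[of "tail p" "tail t"] code_dist_commute[of "tail q" "tail t"]
      have "code_dist (tail p) (tail q) + code_dist (tail t) base < code_dist (tail p) (tail t) +
        code_dist (tail q) base"
        "code_dist (tail p) (tail q) + code_dist (tail t) base < code_dist (tail p) base +
          code_dist (tail q) (tail t)"
        using eqs c Suc.prems by linarith+
      from quartet_with_end[OF base this] eqs c e show ?thesis unfolding e_def[symmetric] by argo
    next
      case 4
      then have eq: "r 0 = p 0" "t 0 = p 0" "p 0 \<noteq> q 0" "q 0 \<noteq> p 0" by auto
      define base where "base = ?b p"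
      have base: "base = entry_code \<or> base = exit_code" by (simp add: base_def)
      have eqs: "2 * code_dist p r = code_dist (tail p) (tail r)"
        "2 * code_dist p t = code_dist (tail p) (tail t)"
        "2 * code_dist r t = code_dist (tail r) (tail t)"
        "2 * code_dist p q = code_dist (tail p) base + 2 * centre_dist q"
        "2 * code_dist q r = code_dist (tail r) base + 2 * centre_dist q"
        "2 * code_dist q t = code_dist (tail t) base + 2 * centre_dist q"
        using eq by (simp_all add: code_dist_same code_dist_diff base_def centre_dist_base[of p]
          centre_dist_base[of r] centre_dist_base[of t])
      note c = code_dist_commute[of "tail r" "tail p"] code_dist_commute[of "tail t" "tail p"]
      have "code_dist (tail r) (tail t) + code_dist (tail p) base < code_dist (tail r) (tail p) +
        code_dist (tail t) base"
        "code_dist (tail r) (tail t) + code_dist (tail p) base < code_dist (tail r) base +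
          code_dist (tail t) (tail p)"
        using eqs c Suc.prems by linarith+
      from quartet_with_end[OF base this] eqs c e show ?thesis unfolding e_def[symmetric] by argo
    next
      case 5
      then have eq: "r 0 = q 0" "t 0 = q 0" "p 0 \<noteq> q 0" by auto
      define base where "base = ?b q"
      have base: "base = entry_code \<or> base = exit_code" by (simp add: base_def)
      have eqs: "2 * code_dist q r = code_dist (tail q) (tail r)"
        "2 * code_dist q t = code_dist (tail q) (tail t)"
        "2 * code_dist r t = code_dist (tail r) (tail t)"
        "2 * code_dist p q = code_dist (tail q) base + 2 * centre_dist p"
        "2 * code_dist p r = code_dist (tail r) base + 2 * centre_dist p"
        "2 * code_dist p t = code_dist (tail t) base + 2 * centre_dist p"
        using eq by (simp_all add: code_dist_same code_dist_diff base_def centre_dist_base[of q]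
          centre_dist_base[of r] centre_dist_base[of t])
      note c = code_dist_commute[of "tail r" "tail q"] code_dist_commute[of "tail t" "tail q"]
      have "code_dist (tail r) (tail t) + code_dist (tail q) base < code_dist (tail r) (tail q) +
        code_dist (tail t) base"
        "code_dist (tail r) (tail t) + code_dist (tail q) base < code_dist (tail r) base +
          code_dist (tail t) (tail q)"
        using eqs c Suc.prems by linarith+
      from quartet_with_end[OF base this] eqs c e show ?thesis unfolding e_def[symmetric] by argo
    next
      case 6
      have "p 0 = q 0 \<or> r 0 = t 0"
      proof (rule ccontr)
        assume "\<not> (p 0 = q 0 \<or> r 0 = t 0)"
        with code_dist_diff[of p q] code_dist_diff[of r t] Suc.prems(1)
          code_dist_le_centre_sum[of p r] code_dist_le_centre_sum[of q t]
        show False by linarith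
      qed
      then show ?thesis
      proof
        assume pq: "p 0 = q 0"
        with 6 have "p 0 \<noteq> r 0" "p 0 \<noteq> t 0" "q 0 \<noteq> r 0" "q 0 \<noteq> t 0" by auto
        then have eqs: "code_dist p r = centre_dist p + centre_dist r" "code_dist p t = centre_dist
          p + centre_dist t"
          "code_dist q r = centre_dist q + centre_dist r" "code_dist q t = centre_dist q + centre_dist t"
          by (simp_all add: code_dist_diff)
        from code_dist_le_centre[of p q, OF pq] eqs code_dist_le_centre_sum[of r t] e show ?thesis
          unfolding e_def[symmetric] by argo
      next
        assume rt: "r 0 = t 0"
        with 6 have "p 0 \<noteq> r 0" "p 0 \<noteq> t 0" "q 0 \<noteq> r 0" "q 0 \<noteq> t 0" by auto
        then have eqs: "code_dist p r = centre_dist p + centre_dist r" "code_dist p t = centre_dist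
          p + centre_dist t"
          "code_dist q r = centre_dist q + centre_dist r" "code_dist q t = centre_dist q + centre_dist t"
          by (simp_all add: code_dist_diff)
        from code_dist_le_centre[of r t, OF rt] eqs code_dist_le_centre_sum[of p q] e show ?thesis
          unfolding e_def[symmetric] by argo
      qed
    qed
  qed
  from disj4_le_if_half_power[OF this[OF assms]] show ?thesis .
qed

subsection \<open>Codes of points in the diamond\<close>

definition diamond :: "complex set" where
  "diamond = {z. \<bar>Im z\<bar> \<le> Re z \<and> \<bar>Im z\<bar> \<le> 1 - Re z}"

definition quad_map :: "quadrant \<Rightarrow> complex \<Rightarrow> complex" where
  "quad_map q z = (case q of QA \<Rightarrow> z / 2 | QB \<Rightarrow> 1/2 + \<i> / 2 * z | QC
    \<Rightarrow> 1/2 + z / 2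
     | QD \<Rightarrow> 1/2 - \<i> / 2 * z)"

text \<open>A relation, because points on common boundaries of quadrants have several codes.
  \<open>Z n\<close> is the position of the point in the coordinates of its diamond after
  \<open>n\<close> descents.\<close>

definition realizes :: "code \<Rightarrow> (nat \<Rightarrow> complex) \<Rightarrow> bool" where
  "realizes s Z \<longleftrightarrow> (\<forall>n. Z n \<in> diamond \<and> Z n = quad_map (s n) (Z
    (Suc n)))"

lemma realizes_tail: "realizes s Z \<Longrightarrow> realizes (tail s) (\<lambda>n. Z (Suc n))"
  unfolding realizes_def tail_def by blast

lemma realizes_mem: "realizes s Z \<Longrightarrow> Z n \<in> diamond"
  and realizes_0: "realizes s Z \<Longrightarrow> Z 0 = quad_map (s 0) (Z 1)"
  unfolding realizes_def One_nat_def by blast+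

lemma realizes_bounds:
  assumes "realizes s Z"
  shows "\<bar>Im (Z n)\<bar> \<le> Re (Z n)" "\<bar>Im (Z n)\<bar> \<le> 1 - Re (Z n)"
  using realizes_mem[OF assms, of n] by (auto simp: diamond_def)

lemma le_add_half_power: "a \<le> b \<Longrightarrow> 0 \<le> c \<Longrightarrow> a \<le> b + c *
  (1/2) ^ n" for a b c :: real
  by (simp add: add_increasing2)

lemma realizes_Re_Im:
  assumes "realizes s Z"
  shows "s 0 = QA \<Longrightarrow> Re (Z 0) = Re (Z 1) / 2 \<and> Im (Z 0) = Im (Z 1) / 2"
    and "s 0 = QC \<Longrightarrow> Re (Z 0) = 1/2 + Re (Z 1) / 2 \<and> Im (Z 0) = Im (Z 1) / 2"
    and "s 0 = QB \<Longrightarrow> Re (Z 0) = 1/2 - Im (Z 1) / 2 \<and> Im (Z 0) = Re (Z 1) / 2"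
    and "s 0 = QD \<Longrightarrow> Re (Z 0) = 1/2 + Im (Z 1) / 2 \<and> Im (Z 0) = - Re (Z 1) / 2"
proof -
  have "Re (Z 0) = Re (quad_map (s 0) (Z 1))" "Im (Z 0) = Im (quad_map (s 0) (Z 1))"
    using realizes_0[OF assms] by simp_all
  then show "s 0 = QA \<Longrightarrow> Re (Z 0) = Re (Z 1) / 2 \<and> Im (Z 0) = Im (Z 1) / 2"
    and "s 0 = QC \<Longrightarrow> Re (Z 0) = 1/2 + Re (Z 1) / 2 \<and> Im (Z 0) = Im (Z 1) / 2"
    and "s 0 = QB \<Longrightarrow> Re (Z 0) = 1/2 - Im (Z 1) / 2 \<and> Im (Z 0) = Re (Z 1) / 2"
    and "s 0 = QD \<Longrightarrow> Re (Z 0) = 1/2 + Im (Z 1) / 2 \<and> Im (Z 0) = - Re (Z 1) / 2"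
    by (simp_all add: quad_map_def)
qed

text \<open>The digit \<open>QA\<close> halves both sides. The other quadrants lie in
  \<open>Re z \<ge> 1/4\<close>, where the trivial bound 1 suffices; hence the factor 4.\<close>

lemma entry_dist_le_Re: "realizes s Z \<Longrightarrow> entry_dist s \<le> 4 * Re (Z 0)"
proof -
  have "realizes s Z \<Longrightarrow> entry_dist s \<le> 4 * Re (Z 0) + 1 * (1/2) ^ n" for n
  proof (induction n arbitrary: s Z)
    case 0
    then show ?case using entry_dist_bounds[of s] realizes_bounds[of s Z 0] by simp
  next
    case (Suc n)
    show ?case
    proof (cases "s 0 = QA")
      case True
      with Suc.IH[OF realizes_tail[OF Suc.prems]] realizes_Re_Im(1)[OF Suc.prems]
      show ?thesis by (simp add: entry_dist_rec[of s])
    next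
      case False
      then have "1/4 \<le> Re (Z 0)"
        using realizes_Re_Im[OF Suc.prems] realizes_bounds[OF Suc.prems, of 1]
        by (cases "s 0") auto
      with entry_dist_bounds[of s] show ?thesis by (intro le_add_half_power) auto
    qed
  qed
  from le_if_le_add_half_power[OF this] show "realizes s Z \<Longrightarrow> entry_dist s \<le> 4 *
    Re (Z 0)" .
qed

lemma exit_dist_le_Re: "realizes s Z \<Longrightarrow> exit_dist s \<le> 4 * (1 - Re (Z 0))"
proof -
  have "realizes s Z \<Longrightarrow> exit_dist s \<le> 4 * (1 - Re (Z 0)) + 1 * (1/2) ^ n" for n
  proof (induction n arbitrary: s Z)
    case 0
    then show ?case using exit_dist_bounds[of s] realizes_bounds[of s Z 0] by simp
  next
    case (Suc n)
    show ?case
    proof (cases "s 0 = QC")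
      case True
      with Suc.IH[OF realizes_tail[OF Suc.prems]] realizes_Re_Im(2)[OF Suc.prems]
      show ?thesis by (simp add: exit_dist_rec[of s])
    next
      case False
      then have "1/4 \<le> 1 - Re (Z 0)"
        using realizes_Re_Im[OF Suc.prems] realizes_bounds[OF Suc.prems, of 1]
        by (cases "s 0") auto
      with exit_dist_bounds[of s] show ?thesis by (intro le_add_half_power) auto
    qed
  qed
  from le_if_le_add_half_power[OF this] show "realizes s Z \<Longrightarrow> exit_dist s \<le> 4 *
    (1 - Re (Z 0))" .
qed

section \<open>The tree metric dominates the Euclidean distance\<close>

lemma norm_diamond_le:
  assumes "z \<in> diamond" shows "norm z \<le> 1" "norm (1 - z) \<le> 1"
proof -
  have b: "\<bar>Im z\<bar> \<le> Re z" "\<bar>Im z\<bar> \<le> 1 - Re z" using assms by (auto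
    simp: diamond_def)
  have "norm z \<le> \<bar>Re z\<bar> + \<bar>Im z\<bar>" by (rule cmod_le)
  with b show "norm z \<le> 1" by linarith
  have "norm (1 - z) \<le> \<bar>Re (1 - z)\<bar> + \<bar>Im (1 - z)\<bar>" by (rule cmod_le)
  with b show "norm (1 - z) \<le> 1" by simp
qed

lemma norm_le_entry_dist: "realizes s Z \<Longrightarrow> norm (Z 0) \<le> entry_dist s"
proof -
  have "realizes s Z \<Longrightarrow> norm (Z 0) \<le> entry_dist s + 1 * (1/2) ^ n" for n
  proof (induction n arbitrary: s Z)
    case 0
    then show ?case using entry_dist_bounds[of s] norm_diamond_le(1)[OF realizes_mem[OF 0, of 0]] by simp
  next
    case (Suc n)
    have IH: "norm (Z 1) \<le> entry_dist (tail s) + (1/2) ^ n"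
      using Suc.IH[OF realizes_tail[OF Suc.prems]] by simp
    have Z: "Z 0 = quad_map (s 0) (Z 1)" using Suc.prems by (rule realizes_0)
    have "norm (Z 0) \<le> (of_bool (s 0 \<noteq> QA) + norm (Z 1)) / 2"
    proof (cases "s 0")
      case QB
      with Z norm_triangle_ineq[of "1/2" "\<i> / 2 * Z 1"] show ?thesis by (simp add: quad_map_def
        norm_mult)
    next
      case QC
      with Z norm_triangle_ineq[of "1/2" "Z 1 / 2"] show ?thesis by (simp add: quad_map_def norm_divide)
    next
      case QD
      with Z norm_triangle_ineq4[of "1/2" "\<i> / 2 * Z 1"] show ?thesis by (simp add: quad_map_def
        norm_mult)
    next
      case QA
      then show ?thesis unfolding Z by (simp add: quad_map_def norm_divide)
    qed
    with IH show ?case by (auto simp: entry_dist_rec[of s] add_divide_distrib)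
  qed
  from le_if_le_add_half_power[OF this] show "realizes s Z \<Longrightarrow> norm (Z 0) \<le>
    entry_dist s" .
qed

lemma norm_le_exit_dist: "realizes s Z \<Longrightarrow> norm (1 - Z 0) \<le> exit_dist s"
proof -
  have "realizes s Z \<Longrightarrow> norm (1 - Z 0) \<le> exit_dist s + 1 * (1/2) ^ n" for n
  proof (induction n arbitrary: s Z)
    case 0
    then show ?case using exit_dist_bounds[of s] norm_diamond_le(2)[OF realizes_mem[OF 0, of 0]] by simp
  next
    case (Suc n)
    have IH: "norm (1 - Z 1) \<le> exit_dist (tail s) + (1/2) ^ n"
      using Suc.IH[OF realizes_tail[OF Suc.prems]] by simp
    have e: "norm (Z 1) \<le> entry_dist (tail s)" 
      using norm_le_entry_dist[OF realizes_tail[OF Suc.prems]] by simp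
    have Z: "Z 0 = quad_map (s 0) (Z 1)" using Suc.prems by (rule realizes_0)
    show ?case
    proof (cases "s 0")
      case QA
      have "1 - Z 0 = 1/2 + (1 - Z 1) / 2" using Z QA by (simp add: quad_map_def field_simps)
      then have "norm (1 - Z 0) \<le> 1/2 + norm (1 - Z 1) / 2"
        using norm_triangle_ineq[of "1/2" "(1 - Z 1) / 2"] by (simp add: norm_divide)
      with IH QA show ?thesis by (simp add: exit_dist_rec[of s] add_divide_distrib)
    next
      case QB
      have "1 - Z 0 = 1/2 - \<i> / 2 * Z 1" using Z QB by (simp add: quad_map_def field_simps)
      then have "norm (1 - Z 0) \<le> 1/2 + norm (Z 1) / 2"
        using norm_triangle_ineq4[of "1/2" "\<i> / 2 * Z 1"] by (simp add: norm_mult)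
      with e QB have "norm (1 - Z 0) \<le> exit_dist s" by (simp add: exit_dist_rec[of s]
        add_divide_distrib)
      then show ?thesis by (intro le_add_half_power) auto
    next
      case QC
      have "1 - Z 0 = (1 - Z 1) / 2" using Z QC by (simp add: quad_map_def field_simps)
      then have "norm (1 - Z 0) = norm (1 - Z 1) / 2" by (simp only: norm_divide norm_numeral)
      with IH QC show ?thesis by (simp add: exit_dist_rec[of s] add_divide_distrib)
    next
      case QD
      have "1 - Z 0 = 1/2 + \<i> / 2 * Z 1" using Z QD by (simp add: quad_map_def field_simps)
      then have "norm (1 - Z 0) \<le> 1/2 + norm (Z 1) / 2"
        using norm_triangle_ineq[of "1/2" "\<i> / 2 * Z 1"] by (simp add: norm_mult)
      with e QD have "norm (1 - Z 0) \<le> exit_dist s" by (simp add: exit_dist_rec[of s]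
        add_divide_distrib)
      then show ?thesis by (intro le_add_half_power) auto
    qed
  qed
  from le_if_le_add_half_power[OF this] show "realizes s Z \<Longrightarrow> norm (1 - Z 0) \<le>
    exit_dist s" .
qed

lemma norm_le_centre_dist:
  assumes "realizes s Z" shows "norm (Z 0 - 1/2) \<le> centre_dist s"
proof -
  have Z: "Z 0 = quad_map (s 0) (Z 1)" using assms by (rule realizes_0)
  have e: "norm (Z 1) \<le> entry_dist (tail s)" "norm (1 - Z 1) \<le> exit_dist (tail s)"
    using norm_le_entry_dist[OF realizes_tail[OF assms]] norm_le_exit_dist[OF realizes_tail[OF
      assms]] by simp_all
  show ?thesis
  proof (cases "s 0")
    case QA
    then have "Z 0 - 1/2 = - ((1 - Z 1) / 2)" using Z by (simp add: quad_map_def field_simps)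
    then show ?thesis using e QA by (simp add: centre_dist_def norm_divide norm_minus_cancel del:
      minus_diff_eq)
  qed (use Z e in \<open>simp_all add: quad_map_def centre_dist_def norm_divide norm_mult\<close>)
qed

text \<open>Equal digits halve both sides, as the maps onto the quadrants are similarities. At the
  first difference the triangle inequality goes through the centre.\<close>

lemma norm_le_code_dist: "realizes s Z \<Longrightarrow> realizes t W \<Longrightarrow> norm (Z 0 -
  W 0) \<le> code_dist s t"
proof -
  have "realizes s Z \<Longrightarrow> realizes t W \<Longrightarrow> norm (Z 0 - W 0) \<le>
    code_dist s t + 2 * (1/2) ^ n" for n
  proof (induction n arbitrary: s t Z W)
    case 0
    have "norm (Z 0) \<le> 1" "norm (W 0) \<le> 1"
      using 0 norm_diamond_le(1) realizes_mem by blast+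
    then show ?case using code_dist_bounds[of s t] norm_triangle_ineq4[of "Z 0" "W 0"] by simp
  next
    case (Suc n)
    show ?case
    proof (cases "s 0 = t 0")
      case True
      have "norm (Z 1 - W 1) \<le> code_dist (tail s) (tail t) + 2 * (1/2) ^ n"
        using Suc.IH[OF Suc.prems[THEN realizes_tail]] by simp
      moreover have "norm (Z 0 - W 0) = norm (Z 1 - W 1) / 2"
      proof -
        have "Z 0 = quad_map (s 0) (Z 1)" "W 0 = quad_map (s 0) (W 1)"
          using realizes_0[OF Suc.prems(1)] realizes_0[OF Suc.prems(2)] True by simp_all
        moreover have "norm (quad_map q a - quad_map q b) = norm (a - b) / 2" for q a b
        proof -
          have "quad_map q a - quad_map q b = (case q of QA \<Rightarrow> 1/2 | QB \<Rightarrow>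
            \<i>/2 | QC \<Rightarrow> 1/2 | QD \<Rightarrow> - \<i>/2) * (a - b)"
            by (simp add: quad_map_def field_simps split: quadrant.split)
          then show ?thesis by (simp add: norm_mult norm_divide split: quadrant.split)
        qed
        ultimately show ?thesis by simp
      qed
      ultimately show ?thesis using True by (simp add: code_dist_same)
    next
      case False
      have "norm (Z 0 - W 0) \<le> norm (Z 0 - 1/2) + norm (W 0 - 1/2)"
        using norm_triangle_ineq4[of "Z 0 - 1/2" "W 0 - 1/2"] by simp
      also have "\<dots> \<le> code_dist s t"
        using norm_le_centre_dist[OF Suc.prems(1)] norm_le_centre_dist[OF Suc.prems(2)]
          code_dist_diff[of s t] False
        by simp
      finally show ?thesis by (intro le_add_half_power) auto
    qed
  qed
  from le_if_le_add_half_power[OF this] show "realizes s Z \<Longrightarrow> realizes t W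
    \<Longrightarrow> norm (Z 0 - W 0) \<le> code_dist s t" .
qed

section \<open>Heights above the axis and positions on it\<close>

definition height :: "code \<Rightarrow> real" where
  "height s = (entry_dist s + exit_dist s - 1) / 2"

lemma height_nonneg: "0 \<le> height s"
  using entry_plus_exit[of s] by (simp add: height_def)

text \<open>The path from the entry follows the axis up to \<open>axis_pos s\<close> and then a
  branch of length \<open>height s\<close>.\<close>

lemma axis_pos_plus_height: "axis_pos s + height s = entry_dist s"
  by (simp add: axis_pos_def height_def field_simps)

lemma height_rec:
  "height s = (if s 0 \<in> {QA, QC} then height (tail s) else entry_dist (tail s)) / 2"
  by (auto simp: height_def entry_dist_rec[of s] exit_dist_rec[of s] field_simps split: quadrant.split)

text \<open>Both sides are halved while the code stays on the axis. At the first branching the axis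
  of the side quadrant is perpendicular, and \<open>entry_dist_le_Re\<close> applies to it.\<close>

lemma height_le_Im: "realizes s Z \<Longrightarrow> height s \<le> 4 * \<bar>Im (Z 0)\<bar>"
proof -
  have "realizes s Z \<Longrightarrow> height s \<le> 4 * \<bar>Im (Z 0)\<bar> + 1 * (1/2) ^ n" for n
  proof (induction n arbitrary: s Z)
    case 0
    then show ?case using entry_dist_bounds[of s] exit_dist_bounds[of s] by (simp add: height_def
      field_simps)
  next
    case (Suc n)
    show ?case
    proof (cases "s 0 \<in> {QA, QC}")
      case True
      with Suc.IH[OF realizes_tail[OF Suc.prems]] realizes_Re_Im(1,2)[OF Suc.prems]
      show ?thesis by (auto simp: height_rec[of s])
    next
      case False
      then have "\<bar>Im (Z 0)\<bar> = Re (Z 1) / 2"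
        using realizes_Re_Im(3,4)[OF Suc.prems] realizes_bounds[OF Suc.prems, of 1]
        by (cases "s 0") auto
      moreover have "entry_dist (tail s) \<le> 4 * Re (Z 1)"
        using entry_dist_le_Re[OF realizes_tail[OF Suc.prems]] by simp
      ultimately have "height s \<le> 4 * \<bar>Im (Z 0)\<bar>" using False by (auto simp:
        height_rec[of s])
      then show ?thesis by (rule le_add_half_power) simp
    qed
  qed
  from le_if_le_add_half_power[OF this] show "realizes s Z \<Longrightarrow> height s \<le> 4 *
    \<bar>Im (Z 0)\<bar>" .
qed

text \<open>At a branching \<open>axis_pos\<close> is 1/2. The side diamond satisfies
  \<open>\<bar>Im (Z 1)\<bar> \<le> Re (Z 1)\<close>, and its coordinates are turned by 90
  degrees.\<close>

lemma axis_pos_approx_Re: "realizes s Z \<Longrightarrow> \<bar>axis_pos s - Re (Z 0)\<bar> \<le>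
  \<bar>Im (Z 0)\<bar>"
proof -
  have "realizes s Z \<Longrightarrow> \<bar>axis_pos s - Re (Z 0)\<bar> \<le> \<bar>Im (Z 0)\<bar>
    + 1 * (1/2) ^ n" for n
  proof (induction n arbitrary: s Z)
    case 0
    then show ?case using axis_pos_bounds[of s] realizes_bounds[OF 0, of 0] by simp
  next
    case (Suc n)
    have p: "0 \<le> (1/2::real) ^ Suc n" by simp
    show ?case
    proof (cases "s 0 \<in> {QA, QC}")
      case True
      with realizes_Re_Im(1,2)[OF Suc.prems]
      have "axis_pos s - Re (Z 0) = (axis_pos (tail s) - Re (Z 1)) / 2" "Im (Z 0) = Im (Z 1) / 2"
        by (auto simp: axis_pos_rec[of s] add_divide_distrib diff_divide_distrib)
      with Suc.IH[OF realizes_tail[OF Suc.prems]]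
      show ?thesis by simp
    next
      case False
      then have "\<bar>axis_pos s - Re (Z 0)\<bar> \<le> \<bar>Im (Z 0)\<bar>"
        using realizes_Re_Im(3,4)[OF Suc.prems] realizes_bounds[OF Suc.prems, of 1]
        by (cases "s 0") (auto simp: axis_pos_rec[of s])
      with p show ?thesis by linarith
    qed
  qed
  from le_if_le_add_half_power[OF this] show "realizes s Z \<Longrightarrow> \<bar>axis_pos s - Re
    (Z 0)\<bar> \<le> \<bar>Im (Z 0)\<bar>" .
qed

text \<open>Whether a coded point lies on the upper (lower) side of its axis: the first branching off
  the axis, if any, is not to the lower (upper) side.\<close>

definition avoids :: "quadrant \<Rightarrow> code \<Rightarrow> bool" where
  "avoids q s \<longleftrightarrow> (\<forall>n. (\<forall>k<n. s k \<in> {QA, QC})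
    \<longrightarrow> s n \<noteq> q)"

lemma avoids_0: "avoids q s \<Longrightarrow> s 0 \<noteq> q"
  unfolding avoids_def by blast

lemma avoids_tail: "avoids q s \<Longrightarrow> s 0 \<in> {QA, QC} \<Longrightarrow> avoids q (tail s)"
  unfolding avoids_def tail_def by (metis less_Suc_eq_0_disj)

lemma centre_dist_axis: "centre_dist s = height s + \<bar>1/2 - axis_pos s\<bar>"
  using axis_pos_bounds[of "tail s"] axis_pos_plus_height[of "tail s"] entry_dist_bounds[of "tail s"]
    exit_dist_bounds[of "tail s"]
  by (cases "s 0") (auto simp: centre_dist_def height_rec[of s] axis_pos_rec[of s] axis_pos_def[of
    "tail s"]
      height_def[of "tail s"] add_divide_distrib diff_divide_distrib)

text \<open>The two points never share a side quadrant, so the path between them goes down to the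
  axis, along it and up again.\<close>

lemma code_dist_opposite:
  "avoids QD s \<Longrightarrow> avoids QB t \<Longrightarrow> code_dist s t \<le> height s +
    height t + \<bar>axis_pos s - axis_pos t\<bar>"
proof -
  have "avoids QD s \<Longrightarrow> avoids QB t \<Longrightarrow>
     code_dist s t \<le> height s + height t + \<bar>axis_pos s - axis_pos t\<bar> + 1 * (1/2) ^ n" for n
  proof (induction n arbitrary: s t)
    case 0
    show ?case using code_dist_bounds[of s t] height_nonneg[of s] height_nonneg[of t] by simp
  next
    case (Suc n)
    show ?case
    proof (cases "s 0 = t 0")
      case True
      with avoids_0[OF Suc.prems(1)] avoids_0[OF Suc.prems(2)] have ac: "s 0 \<in> {QA, QC}"
        by (cases "s 0") auto
      have "axis_pos s - axis_pos t = (axis_pos (tail s) - axis_pos (tail t)) / 2"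
        "height s = height (tail s) / 2" "height t = height (tail t) / 2"
        "code_dist s t = code_dist (tail s) (tail t) / 2"
        using ac True by (auto simp: axis_pos_rec[of s] axis_pos_rec[of t] height_rec[of s]
            height_rec[of t] code_dist_same add_divide_distrib diff_divide_distrib)
      with Suc.IH[OF avoids_tail[OF Suc.prems(1)] avoids_tail[OF Suc.prems(2)]] ac True
      show ?thesis by simp
    next
      case False
      have "code_dist s t = centre_dist s + centre_dist t" using False by (rule code_dist_diff)
      moreover have "\<bar>1/2 - axis_pos s\<bar> + \<bar>1/2 - axis_pos t\<bar> = \<bar>axis_pos s
        - axis_pos t\<bar>"
        using False axis_pos_bounds[of "tail s"] axis_pos_bounds[of "tail t"]
        by (cases "s 0"; cases "t 0") (auto simp: axis_pos_rec[of s] axis_pos_rec[of t])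
      ultimately have "code_dist s t \<le> height s + height t + \<bar>axis_pos s - axis_pos t\<bar>"
        by (simp add: centre_dist_axis)
      then show ?thesis by (rule le_add_half_power) simp
    qed
  qed
  from le_if_le_add_half_power[OF this] show "avoids QD s \<Longrightarrow> avoids QB t \<Longrightarrow>
     code_dist s t \<le> height s + height t + \<bar>axis_pos s - axis_pos t\<bar>" .
qed

text \<open>The weight 5 consists of 4 from the height and 1 from the error of the position on the
  axis.\<close>

lemma code_dist_across_axis:
  assumes "realizes s Z" "realizes t W" "avoids QD s" "avoids QB t"
    and "0 \<le> Im (Z 0)" "Im (W 0) \<le> 0"
  shows "code_dist s t \<le> 5 * (Im (Z 0) - Im (W 0)) + \<bar>Re (Z 0) - Re (W 0)\<bar>"
proof -
  have "code_dist s t \<le> height s + height t + \<bar>axis_pos s - axis_pos t\<bar>"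
    by (rule code_dist_opposite) fact+
  with height_le_Im[OF assms(1)] height_le_Im[OF assms(2)]
    axis_pos_approx_Re[OF assms(1)] axis_pos_approx_Re[OF assms(2)] assms(5,6)
  show ?thesis unfolding right_diff_distrib by linarith
qed

section \<open>Points separated by the cut through the centre\<close>

lemma entry_dist_le_axis: "realizes s Z \<Longrightarrow> entry_dist s \<le> Re (Z 0) + 5 *
  \<bar>Im (Z 0)\<bar>"
  using axis_pos_plus_height[of s] height_le_Im[of s Z] axis_pos_approx_Re[of s Z] by linarith

text \<open>This and the next three lemmas treat the pairs of quadrants that the cut
  \<open>Re z = 1/2\<close> can separate. The weight across the cut is at most 5, the weight along
  it at most 1.\<close>

lemma code_dist_A_C:
  assumes "realizes s Z" "realizes t W" "s 0 = QA" "t 0 = QC"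
  shows "code_dist s t \<le> 4 * (Re (W 0) - Re (Z 0))"
  using exit_dist_le_Re[OF realizes_tail[OF assms(1)]] entry_dist_le_Re[OF realizes_tail[OF assms(2)]]
    realizes_Re_Im(1)[OF assms(1,3)] realizes_Re_Im(2)[OF assms(2,4)] code_dist_diff[of s t] assms(3,4)
  by (simp add: centre_dist_def)

lemma code_dist_A_side:
  assumes "realizes s Z" "realizes t W" "s 0 = QA" "t 0 \<in> {QB, QD}" "1/2 \<le> Re (W 0)"
  shows "code_dist s t \<le> 5 * (Re (W 0) - Re (Z 0)) + \<bar>Im (W 0) - Im (Z 0)\<bar>"
proof -
  have 1: "code_dist s t = exit_dist (tail s) / 2 + entry_dist (tail t) / 2"
    using assms(3,4) code_dist_diff[of s t] by (auto simp: centre_dist_def)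
  have 2: "exit_dist (tail s) \<le> 4 * (1 - Re (Z 1))"
    using exit_dist_le_Re[OF realizes_tail[OF assms(1)]] by simp
  have 3: "entry_dist (tail t) \<le> Re (W 1) + 5 * \<bar>Im (W 1)\<bar>"
    using entry_dist_le_axis[OF realizes_tail[OF assms(2)]] by simp
  have 4: "Re (W 1) = 2 * \<bar>Im (W 0)\<bar>" "\<bar>Im (W 1)\<bar> = 2 * (Re (W 0) - 1/2)"
    using realizes_Re_Im(3,4)[OF assms(2)] realizes_bounds[OF assms(2), of 1] assms(4,5) by auto
  have 5: "Re (Z 1) = 2 * Re (Z 0)" "Im (Z 1) = 2 * Im (Z 0)"
    using realizes_Re_Im(1)[OF assms(1,3)] by auto
  \<comment> \<open>This turns the term in \<open>Im (W 0)\<close> into the difference of the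
    imaginary parts, at the price of raising the weight of \<open>1/2 - Re (Z 0)\<close> from 4 to
    5.\<close>
  have "\<bar>Im (Z 1)\<bar> \<le> 1 - Re (Z 1)" by (rule realizes_bounds[OF assms(1)])
  with 1 2 3 4 5 show ?thesis by argo
qed

lemma code_dist_C_side:
  assumes "realizes s Z" "realizes t W" "s 0 = QC" "t 0 \<in> {QB, QD}" "Re (W 0) \<le> 1/2"
  shows "code_dist s t \<le> 5 * (Re (Z 0) - Re (W 0)) + \<bar>Im (W 0) - Im (Z 0)\<bar>"
proof -
  have 1: "code_dist s t = entry_dist (tail s) / 2 + entry_dist (tail t) / 2"
    using assms(3,4) code_dist_diff[of s t] by (auto simp: centre_dist_def)
  have 2: "entry_dist (tail s) \<le> 4 * Re (Z 1)"
    using entry_dist_le_Re[OF realizes_tail[OF assms(1)]] by simp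
  have 3: "entry_dist (tail t) \<le> Re (W 1) + 5 * \<bar>Im (W 1)\<bar>"
    using entry_dist_le_axis[OF realizes_tail[OF assms(2)]] by simp
  have 4: "Re (W 1) = 2 * \<bar>Im (W 0)\<bar>" "\<bar>Im (W 1)\<bar> = 2 * (1/2 - Re (W 0))"
    using realizes_Re_Im(3,4)[OF assms(2)] realizes_bounds[OF assms(2), of 1] assms(4,5) by auto
  have 5: "Re (Z 1) = 2 * Re (Z 0) - 1" "Im (Z 1) = 2 * Im (Z 0)"
    using realizes_Re_Im(2)[OF assms(1,3)] by auto
  have "\<bar>Im (Z 1)\<bar> \<le> Re (Z 1)" by (rule realizes_bounds[OF assms(1)])
  with 1 2 3 4 5 show ?thesis by argo
qed

text \<open>The cut is the axis of the common side quadrant, so \<open>code_dist_across_axis\<close>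
  applies there; the quarter turn exchanges real and imaginary parts.\<close>

lemma code_dist_side_side:
  assumes "realizes s Z" "realizes t W" "s 0 = t 0" "s 0 \<in> {QB, QD}"
    and "avoids QD (tail s)" "avoids QB (tail t)" "0 \<le> Im (Z 1)" "Im (W 1) \<le> 0"
  shows "code_dist s t \<le> 5 * \<bar>Re (Z 0) - Re (W 0)\<bar> + \<bar>Im (Z 0) - Im (W 0)\<bar>"
proof -
  have "code_dist (tail s) (tail t) \<le> 5 * (Im (Z 1) - Im (W 1)) + \<bar>Re (Z 1) - Re (W 1)\<bar>"
    using code_dist_across_axis[OF realizes_tail[OF assms(1)] realizes_tail[OF assms(2)]]
      assms(5-8) by simp
  moreover have "Im (Z 1) - Im (W 1) = 2 * \<bar>Re (Z 0) - Re (W 0)\<bar>"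
    using realizes_Re_Im(3,4)[OF assms(1)] realizes_Re_Im(3,4)[OF assms(2)] assms(3,4,7,8) by auto
  moreover have "Re (Z 1) - Re (W 1) = 2 * (Im (Z 0) - Im (W 0)) \<or>
      Re (Z 1) - Re (W 1) = - (2 * (Im (Z 0) - Im (W 0)))"
    using realizes_Re_Im(3,4)[OF assms(1)] realizes_Re_Im(3,4)[OF assms(2)] assms(3,4) by auto
  then have "\<bar>Re (Z 1) - Re (W 1)\<bar> = 2 * \<bar>Im (Z 0) - Im (W 0)\<bar>"
    by (elim disjE) (simp_all only: abs_minus_cancel abs_mult abs_numeral)
  ultimately show ?thesis by (simp add: code_dist_same[of s t, OF assms(3)])
qed

subsection \<open>Bisection of triangles\<close>

definition triangle :: "complex set" where
  "triangle = {z. 0 \<le> Im z \<and> Im z \<le> Re z \<and> Im z \<le> 1 - Re z}"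

text \<open>The right isosceles triangle with hypotenuse from 0 to 1 is bisected by the line \<open>Re z =
  1/2\<close>; \<open>zoom\<close> maps the half containing the point back to the whole triangle.\<close>

definition right :: "complex \<Rightarrow> bool" where
  "right z \<longleftrightarrow> Re z > 1/2"

definition zoom :: "complex \<Rightarrow> complex" where
  "zoom z = (if right z then (1 + \<i>) * (1 - z) else 1 - (1 - \<i>) * z)"

text \<open>The inverse of the left branch of \<open>zoom\<close>.\<close>

definition shrink :: "complex \<Rightarrow> complex" where
  "shrink z = (1 + \<i>) / 2 * (1 - z)"

lemma zoom_triangle: "z \<in> triangle \<Longrightarrow> zoom z \<in> triangle"
  by (auto simp: triangle_def zoom_def right_def)

lemma shrink_triangle: "z \<in> triangle \<Longrightarrow> shrink z \<in> triangle"
  by (auto simp: triangle_def shrink_def field_simps)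

lemma not_right_shrink: "z \<in> triangle \<Longrightarrow> \<not> right (shrink z)"
  by (auto simp: triangle_def shrink_def right_def field_simps)

lemma zoom_shrink: "z \<in> triangle \<Longrightarrow> zoom (shrink z) = z"
  using not_right_shrink[of z] by (auto simp: zoom_def shrink_def complex_eq_iff field_simps)

lemma norm_zoom_diff:
  assumes "right z = right w" shows "norm (zoom z - zoom w) = sqrt 2 * norm (z - w)"
proof -
  have n: "norm (1 + \<i>) = sqrt 2" "norm (1 - \<i>) = sqrt 2" by (simp_all add: cmod_def)
  from n(2) have "norm (\<i> - 1) = sqrt 2" by (simp add: norm_minus_commute)
  note n = n this
  have "zoom z - zoom w = (if right z then (1 + \<i>) * (w - z) else (1 - \<i>) * (w - z))"
    using assms by (simp add: zoom_def algebra_simps)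
  then show ?thesis by (simp add: norm_mult n norm_minus_commute)
qed

lemma norm_shrink_diff: "norm (shrink z - shrink w) = norm (z - w) / sqrt 2"
proof -
  have "norm (1 + \<i>) = sqrt 2" by (simp add: cmod_def)
  then have n: "norm ((1 + \<i>) / 2) = 1 / sqrt 2" by (simp add: norm_divide real_div_sqrt field_simps)
  have "shrink z - shrink w = (1 + \<i>) / 2 * (w - z)"
    unfolding shrink_def right_diff_distrib[symmetric] by simp
  then show ?thesis by (simp only: norm_mult n) (simp add: norm_minus_commute)
qed

type_synonym state = "complex \<times> bool"

text \<open>In a state \<open>(z, f)\<close> the triangle is the upper half of the diamond, or, if \<open>f\<close> holds, its
  lower half rotated by 180 degrees. Two bisections of the triangle lead to a quadrant of the
  diamond.\<close>

fun coord :: "state \<Rightarrow> complex" where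
  "coord (z, f) = (if f then 1 - z else z)"

text \<open>Two equal turns lead to the apex of the triangle, which belongs to a side quadrant;
  unequal turns lead to one of the acute corners, the entry and the exit.\<close>

fun quadrant_of :: "state \<Rightarrow> quadrant" where
  "quadrant_of (z, f) = (if right z = right (zoom z) then (if f then QD else QB)
     else if right z = f then QA else QC)"

text \<open>The axis of a side quadrant is part of the first cut, so the first turn tells on which
  side of that axis the point lies.\<close>

fun descend :: "state \<Rightarrow> state" where
  "descend (z, f) = (zoom (zoom z), if right z = right (zoom z) then right z else f)"

definition code_of :: "state \<Rightarrow> code" where
  "code_of st = (\<lambda>n. quadrant_of ((descend ^^ n) st))"

lemma code_of_0 [simp]: "code_of st 0 = quadrant_of st"
  by (simp add: code_of_def)

lemma tail_code_of: "tail (code_of st) = code_of (descend st)"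
  by (simp add: code_of_def tail_def funpow_swap1)

lemma triangle_diamond: "z \<in> triangle \<Longrightarrow> coord (z, f) \<in> diamond"
  by (auto simp: triangle_def diamond_def)

lemma coord_descend: "coord (z, f) = quad_map (quadrant_of (z, f)) (coord (descend (z, f)))"
  by (auto simp: quad_map_def zoom_def complex_eq_iff field_simps)

lemma fst_descend_triangle: "fst st \<in> triangle \<Longrightarrow> fst (descend st) \<in> triangle"
  by (cases st) (simp add: zoom_triangle)

lemma fst_descend_funpow_triangle: "fst st \<in> triangle \<Longrightarrow> fst ((descend ^^ n) st)
  \<in> triangle"
  by (induction n) (auto intro: fst_descend_triangle)

lemma realizes_code_of:
  assumes "fst st \<in> triangle"
  shows "realizes (code_of st) (\<lambda>n. coord ((descend ^^ n) st))"
  unfolding realizes_def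
proof (intro allI conjI)
  fix n
  obtain z f where zf: "(descend ^^ n) st = (z, f)" by fastforce
  have "z \<in> triangle" using fst_descend_funpow_triangle[OF assms, of n] zf by simp
  then show "coord ((descend ^^ n) st) \<in> diamond" unfolding zf by (rule triangle_diamond)
  show "coord ((descend ^^ n) st) = quad_map (code_of st n) (coord ((descend ^^ Suc n) st))"
    unfolding code_of_def funpow.simps o_apply zf by (rule coord_descend)
qed

text \<open>The flag is constant while the code stays on the axis, and each value of it admits only
  one of the side quadrants.\<close>

lemma avoids_code_of: "avoids (if f then QB else QD) (code_of (z, f))"
proof -
  have "(\<forall>k<n. code_of (z, f) k \<in> {QA, QC}) \<longrightarrow> snd ((descend ^^ n) (z,
    f)) = f" for n
  proof (induction n)
    case (Suc n)
    obtain z' f' where zf: "(descend ^^ n) (z, f) = (z', f')" by fastforce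
    show ?case
    proof
      assume *: "\<forall>k<Suc n. code_of (z, f) k \<in> {QA, QC}"
      then have "f' = f" using Suc zf by auto
      moreover have "quadrant_of (z', f') \<in> {QA, QC}" using *[rule_format, of n] zf by (simp
        add: code_of_def)
      ultimately show "snd ((descend ^^ Suc n) (z, f)) = f"
        using zf by (auto split: if_splits)
    qed
  qed simp
  moreover have "quadrant_of st \<noteq> (if snd st then QB else QD)" for st
    by (cases st) auto
  ultimately show ?thesis
    unfolding avoids_def code_of_def by metis
qed

section \<open>Stretch of separated points\<close>

text \<open>Cauchy--Schwarz for the vectors \<open>(5, 1)\<close> and \<open>(Re z, Im z)\<close>.\<close>

lemma weighted_le_norm: "5 * \<bar>Re z\<bar> + \<bar>Im z\<bar> \<le> sqrt 26 * norm z"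
proof -
  have "(5 * \<bar>Re z\<bar> + \<bar>Im z\<bar>)\<^sup>2 \<le> 26 * ((Re z)\<^sup>2 + (Im z)\<^sup>2)"
    using zero_le_power2[of "\<bar>Re z\<bar> - 5 * \<bar>Im z\<bar>"] by (simp add:
      power2_eq_square algebra_simps)
  then have "5 * \<bar>Re z\<bar> + \<bar>Im z\<bar> \<le> sqrt (26 * ((Re z)\<^sup>2 + (Im z)\<^sup>2))"
    by (rule real_le_rsqrt)
  then show ?thesis by (simp add: real_sqrt_mult[symmetric] cmod_def distrib_left)
qed

abbreviation state_dist :: "state \<Rightarrow> state \<Rightarrow> real" where
  "state_dist st st' \<equiv> code_dist (code_of st) (code_of st')"

text \<open>The second turns of \<open>z\<close> and \<open>w\<close> determine the pair of
  quadrants, and each of the four combinations has its lemma. The rotation by \<open>f\<close> may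
  exchange the roles of the two points.\<close>

lemma state_dist_split:
  assumes "z \<in> triangle" "w \<in> triangle" "\<not> right z" "right w"
  shows "state_dist (z, f) (w, f) \<le> sqrt 26 * norm (z - w)"
proof -
  let ?s = "code_of (z, f)" and ?t = "code_of (w, f)"
  define Z where "Z = (\<lambda>n. coord ((descend ^^ n) (z, f)))"
  define W where "W = (\<lambda>n. coord ((descend ^^ n) (w, f)))"
  have rZ: "realizes ?s Z" and rW: "realizes ?t W"
    unfolding Z_def W_def using assms by (auto intro: realizes_code_of)
  have Z0: "Z 0 = (if f then 1 - z else z)" and W0: "W 0 = (if f then 1 - w else w)"
    by (simp_all add: Z_def W_def)
  have Z1: "Z 1 = coord (descend (z, f))" and W1: "W 1 = coord (descend (w, f))"
    by (simp_all add: Z_def W_def)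
  have RZ: "if f then 1/2 \<le> Re (Z 0) \<and> Re (W 0) \<le> 1/2 else Re (Z 0) \<le> 1/2 \<and>
    1/2 \<le> Re (W 0)"
    using assms by (auto simp: Z0 W0 right_def)
  have comm: "code_dist ?t ?s = code_dist ?s ?t" by (rule code_dist_commute)
  have t2: "zoom (zoom z) \<in> triangle" "zoom (zoom w) \<in> triangle"
    using assms by (auto intro: zoom_triangle)
  have "state_dist (z, f) (w, f) \<le> 5 * \<bar>Re (Z 0 - W 0)\<bar> + \<bar>Im (Z 0 - W 0)\<bar>"
  proof (cases "right (zoom z)"; cases "right (zoom w)")
    assume zr: "right (zoom z)" "\<not> right (zoom w)"
    show ?thesis
    proof (cases f)
      case True
      with zr assms have "?t 0 = QA" "?s 0 = QC" by auto
      from code_dist_A_C[OF rW rZ this] comm show ?thesis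
        unfolding minus_complex.sel by argo
    next
      case False
      with zr assms have "?s 0 = QA" "?t 0 = QC" by auto
      from code_dist_A_C[OF rZ rW this] show ?thesis
        unfolding minus_complex.sel by argo
    qed
  next
    assume zr: "right (zoom z)" "right (zoom w)"
    show ?thesis
    proof (cases f)
      case True
      with zr assms have "?s 0 = QC" "?t 0 \<in> {QB, QD}" by auto
      from code_dist_C_side[OF rZ rW this] RZ True comm show ?thesis
        unfolding minus_complex.sel by (simp; argo)
    next
      case False
      with zr assms have "?s 0 = QA" "?t 0 \<in> {QB, QD}" by auto
      from code_dist_A_side[OF rZ rW this] RZ False comm show ?thesis
        unfolding minus_complex.sel by (simp; argo)
    qed
  next
    assume zr: "\<not> right (zoom z)" "\<not> right (zoom w)"
    show ?thesis
    proof (cases f)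
      case True
      with zr assms have "?t 0 = QA" "?s 0 \<in> {QB, QD}" by auto
      from code_dist_A_side[OF rW rZ this] RZ True comm show ?thesis
        unfolding minus_complex.sel by (simp; argo)
    next
      case False
      with zr assms have "?t 0 = QC" "?s 0 \<in> {QB, QD}" by auto
      from code_dist_C_side[OF rW rZ this] RZ False comm show ?thesis
        unfolding minus_complex.sel by (simp; argo)
    qed
  next
    assume zr: "\<not> right (zoom z)" "right (zoom w)"
    have "?s 0 = ?t 0" "?s 0 \<in> {QB, QD}" using zr assms by auto
    moreover have "avoids QD (tail ?s)" "avoids QB (tail ?t)"
      using avoids_code_of[of False "zoom (zoom z)"] avoids_code_of[of True "zoom (zoom w)"] zr assms
      by (simp_all add: tail_code_of)
    moreover have "0 \<le> Im (Z 1)" "Im (W 1) \<le> 0"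
      unfolding Z1 W1 using zr assms t2 by (simp_all add: triangle_def)
    ultimately show ?thesis using code_dist_side_side[OF rZ rW] by simp
  qed
  also have "\<dots> \<le> sqrt 26 * norm (Z 0 - W 0)" by (rule weighted_le_norm)
  also have "norm (Z 0 - W 0) = norm (z - w)" by (simp add: Z0 W0 norm_minus_commute)
  finally show ?thesis .
qed

definition turn :: "nat \<Rightarrow> complex \<Rightarrow> bool" where
  "turn n z = right ((zoom ^^ n) z)"

lemma turn_Suc: "turn (Suc n) z = turn n (zoom z)"
  by (simp add: turn_def funpow_swap1)

lemma turn_0: "turn 0 z = right z"
  by (simp add: turn_def)

text \<open>One digit takes two turns. While these agree, both points descend to the same quadrant
  with the same flag, and tree distance and norm are both halved. A first difference at an odd index
  is left to the other colour.\<close>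

lemma state_dist_le_norm:
  assumes "z \<in> triangle" "w \<in> triangle" "\<forall>m<2 * k. turn m z = turn m w" "turn (2 *
    k) z \<noteq> turn (2 * k) w"
  shows "state_dist (z, f) (w, f) \<le> sqrt 26 * norm (z - w)"
  using assms
proof (induction k arbitrary: z w f)
  case 0
  then show ?case
    using state_dist_split[of z w f] state_dist_split[of w z f]
    by (cases "right z") (auto simp: turn_0 code_dist_commute norm_minus_commute)
next
  case (Suc k)
  have r: "right z = right w" "right (zoom z) = right (zoom w)"
    using Suc.prems(3)[rule_format, of 0] Suc.prems(3)[rule_format, of 1] by (simp_all add: turn_0
      turn_Suc)
  obtain f' where d: "descend (z, f) = (zoom (zoom z), f')" "descend (w, f) = (zoom (zoom w), f')"
    using r by simp
  have "turn m (zoom (zoom z)) = turn m (zoom (zoom w))" if "m < 2 * k" for m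
    using Suc.prems(3)[rule_format, of "Suc (Suc m)"] that by (simp add: turn_Suc)
  moreover have "turn (2 * k) (zoom (zoom z)) \<noteq> turn (2 * k) (zoom (zoom w))"
    using Suc.prems(4) by (simp add: turn_Suc)
  ultimately have "state_dist (zoom (zoom z), f') (zoom (zoom w), f') \<le> sqrt 26 * norm (zoom
    (zoom z) - zoom (zoom w))"
    using Suc.prems(1,2) by (intro Suc.IH) (auto intro: zoom_triangle)
  moreover have "code_of (z, f) 0 = code_of (w, f) 0" using r by simp
  then have "state_dist (z, f) (w, f) = state_dist (zoom (zoom z), f') (zoom (zoom w), f') / 2"
    by (simp only: code_dist_same tail_code_of d)
  moreover have "norm (zoom (zoom z) - zoom (zoom w)) = 2 * norm (z - w)"
    by (simp add: norm_zoom_diff r)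
  ultimately show ?case by simp
qed

text \<open>A common turn stretches the distance by \<open>sqrt 2\<close>, but the triangle is
  bounded.\<close>

lemma turn_separates:
  assumes "z \<in> triangle" "w \<in> triangle" "z \<noteq> w"
  obtains n where "turn n z \<noteq> turn n w" "\<forall>m<n. turn m z = turn m w"
proof -
  have "\<exists>n. turn n z \<noteq> turn n w"
  proof (rule ccontr)
    assume "\<nexists>n. turn n z \<noteq> turn n w"
    then have eq: "right ((zoom ^^ n) z) = right ((zoom ^^ n) w)" for n by (simp add: turn_def)
    have tri: "(zoom ^^ n) v \<in> triangle" if "v \<in> triangle" for n v
      using that by (induction n) (auto intro: zoom_triangle)
    have "norm ((zoom ^^ n) z - (zoom ^^ n) w) = sqrt 2 ^ n * norm (z - w)" for n
      by (induction n) (simp_all add: norm_zoom_diff eq)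
    moreover have "norm ((zoom ^^ n) z - (zoom ^^ n) w) \<le> 2" for n
      using norm_diamond_le(1)[OF triangle_diamond[of _ False]] tri[OF assms(1), of n] tri[OF
        assms(2), of n]
        norm_triangle_ineq4[of "(zoom ^^ n) z" "(zoom ^^ n) w"]
      by (smt (verit) coord.simps)
    ultimately have le: "sqrt 2 ^ n * norm (z - w) \<le> 2" for n by metis
    obtain n where "2 / norm (z - w) < sqrt 2 ^ n"
      using real_arch_pow[of "sqrt 2"] by auto
    with le[of n] assms(3) show False by (simp add: field_simps)
  qed
  then show ?thesis
    using that exists_least_iff[of "\<lambda>n. turn n z \<noteq> turn n w"] by blast
qed

lemma norm_le_state_dist:
  assumes "z \<in> triangle" "w \<in> triangle"
  shows "norm (z - w) \<le> state_dist (z, False) (w, False)"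
  using norm_le_code_dist[OF realizes_code_of realizes_code_of, of "(z, False)" "(w, False)"] assms
    by simp

text \<open>Two steps of \<open>shrink\<close> put the digit \<open>QB\<close> in front of both
  codes.\<close>

lemma state_dist_shrink_shrink:
  assumes "z \<in> triangle" "w \<in> triangle"
  shows "state_dist (shrink (shrink z), False) (shrink (shrink w), False) = state_dist (z, False)
    (w, False) / 2"
proof -
  have d: "descend (shrink (shrink v), False) = (v, False)" "code_of (shrink (shrink v), False) 0 = QB"
    if "v \<in> triangle" for v
    using that by (simp_all add: zoom_shrink shrink_triangle not_right_shrink)
  have "code_of (shrink (shrink z), False) 0 = code_of (shrink (shrink w), False) 0"
    using assms d(2) by metis
  then show ?thesis
    by (simp only: code_dist_same tail_code_of d(1)[OF assms(1)] d(1)[OF assms(2)])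
qed

subsection \<open>The two metrics on the plane\<close>

text \<open>
  The map \<^term>\<open>shrink\<close> contracts towards an interior point of the triangle, so its iterated preimages
  of the triangle exhaust the plane. Two steps of it descend to quadrant \<open>QB\<close>, so that only the
  parity of the number of steps matters; the two parities give the two colours.
\<close>

lemma eventually_shrink_triangle: "\<forall>\<^sub>F n in sequentially. (shrink ^^ n) p \<in> triangle"
proof -
  \<comment> \<open>The fixed point of \<open>shrink\<close>. The square of half-width 1/10 around
    it lies inside the triangle.\<close>
  define c where "c = Complex (2/5) (1/5)"
  have c: "shrink c = c" by (simp add: c_def shrink_def complex_eq_iff)
  have n: "norm ((shrink ^^ n) p - c) = norm (p - c) * (1 / sqrt 2) ^ n" for n
  proof (induction n)
    case (Suc n)
    have "norm ((shrink ^^ Suc n) p - c) = norm (shrink ((shrink ^^ n) p) - shrink c)" by (simp add: c)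
    also have "\<dots> = norm (p - c) * (1 / sqrt 2) ^ Suc n"
      unfolding norm_shrink_diff Suc by simp
    finally show ?case .
  qed simp
  have "(\<lambda>n. norm (p - c) * (1 / sqrt 2) ^ n) \<longlonglongrightarrow> norm (p - c) * 0"
    by (intro tendsto_intros LIMSEQ_power_zero) simp
  from order_tendstoD(2)[OF this, of "1/10"]
  have "\<forall>\<^sub>F n in sequentially. norm ((shrink ^^ n) p - c) < 1/10"
    unfolding n by simp
  then show ?thesis
  proof (rule eventually_mono)
    fix n assume less: "norm ((shrink ^^ n) p - c) < 1/10"
    have "\<bar>Re ((shrink ^^ n) p) - 2/5\<bar> < 1/10" "\<bar>Im ((shrink ^^ n) p) - 1/5\<bar> < 1/10"
      using abs_Re_le_cmod[of "(shrink ^^ n) p - c"] abs_Im_le_cmod[of "(shrink ^^ n) p - c"] less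
      by (simp_all add: c_def)
    then show "(shrink ^^ n) p \<in> triangle" unfolding triangle_def mem_Collect_eq by linarith
  qed
qed

definition scaled_dist :: "nat \<Rightarrow> complex \<Rightarrow> complex \<Rightarrow> real" where
  "scaled_dist n p q = sqrt 2 ^ n * state_dist ((shrink ^^ n) p, False) ((shrink ^^ n) q, False)"

text \<open>The parity \<open>i\<close> is the colour. Any \<open>k\<close> that brings both points
  into the triangle gives the same value, by \<open>plane_dist_eq\<close>.\<close>

definition plane_dist :: "nat \<Rightarrow> complex \<Rightarrow> complex \<Rightarrow> real" where
  "plane_dist i p q = scaled_dist (i + 2 * (LEAST k. (shrink ^^ (i + 2 * k)) p \<in> triangle \<and>
     (shrink ^^ (i + 2 * k)) q \<in> triangle)) p q"

lemma scaled_dist_add: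
  assumes "(shrink ^^ n) p \<in> triangle" "(shrink ^^ n) q \<in> triangle"
  shows "scaled_dist (n + 2 * j) p q = scaled_dist n p q"
proof (induction j)
  case (Suc j)
  have t: "(shrink ^^ m) ((shrink ^^ n) v) \<in> triangle" if "(shrink ^^ n) v \<in> triangle" for m v
    using that by (induction m) (auto intro: shrink_triangle)
  have "(shrink ^^ (n + 2 * j)) p \<in> triangle" "(shrink ^^ (n + 2 * j)) q \<in> triangle"
    using t[OF assms(1), of "2 * j"] t[OF assms(2), of "2 * j"] by (simp_all add:
      funpow_add[symmetric] add.commute flip: o_apply[of "shrink ^^ (2 * j)"])
  from state_dist_shrink_shrink[OF this] have "scaled_dist (n + 2 * Suc j) p q = scaled_dist (n + 2
    * j) p q"
    by (simp add: scaled_dist_def mult.assoc[symmetric, of "sqrt 2" "sqrt 2"])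
  with Suc show ?case by simp
qed simp

lemma plane_dist_eq:
  assumes "(shrink ^^ (i + 2 * k)) p \<in> triangle" "(shrink ^^ (i + 2 * k)) q \<in> triangle"
  shows "plane_dist i p q = scaled_dist (i + 2 * k) p q"
proof -
  define l where "l = (LEAST k. (shrink ^^ (i + 2 * k)) p \<in> triangle \<and> (shrink ^^ (i + 2 *
    k)) q \<in> triangle)"
  have "(shrink ^^ (i + 2 * l)) p \<in> triangle \<and> (shrink ^^ (i + 2 * l)) q \<in> triangle"
    unfolding l_def by (rule LeastI[of _ k]) (use assms in blast)
  moreover have "l \<le> k" unfolding l_def by (rule Least_le) (use assms in blast)
  ultimately have "scaled_dist (i + 2 * l + 2 * (k - l)) p q = scaled_dist (i + 2 * l) p q"
    by (intro scaled_dist_add) auto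
  moreover have "i + 2 * l + 2 * (k - l) = i + 2 * k" using \<open>l \<le> k\<close> by simp
  ultimately show ?thesis by (simp only: plane_dist_def l_def[symmetric])
qed

lemma common_triangle:
  assumes "finite S"
  obtains k where "\<forall>p\<in>S. \<forall>n\<ge>k. (shrink ^^ n) p \<in> triangle"
proof -
  have "\<forall>\<^sub>F n in sequentially. \<forall>p\<in>S. (shrink ^^ n) p \<in> triangle"
    using assms eventually_shrink_triangle by (simp add: eventually_ball_finite)
  then show ?thesis using that unfolding eventually_sequentially by blast
qed

text \<open>A common scale for finitely many points carries statements about several distances over
  from codes to the plane.\<close>

lemma plane_dist_code:
  assumes "finite S"
  shows "\<exists>n. (\<forall>p\<in>S. \<forall>q\<in>S. plane_dist i p q = scaled_dist n p q)
    \<and> (\<forall>p\<in>S. (shrink ^^ n) p \<in> triangle)"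
proof -
  obtain k where k: "\<forall>p\<in>S. \<forall>n\<ge>k. (shrink ^^ n) p \<in> triangle"
    using common_triangle[OF assms] .
  then show ?thesis
    by (intro exI[of _ "i + 2 * k"]) (auto intro!: plane_dist_eq)
qed

lemma plane_dist_refl: "plane_dist i p p = 0"
  by (simp add: plane_dist_def scaled_dist_def)

lemma plane_dist_commute: "plane_dist i p q = plane_dist i q p"
  by (simp add: plane_dist_def scaled_dist_def code_dist_commute conj_commute)

lemma norm_le_plane_dist: "norm (p - q) \<le> plane_dist i p q"
proof -
  obtain n where n: "plane_dist i p q = scaled_dist n p q"
    "(shrink ^^ n) p \<in> triangle" "(shrink ^^ n) q \<in> triangle"
    using plane_dist_code[of "{p, q}" i] by auto
  have "norm ((shrink ^^ n) p - (shrink ^^ n) q) = norm (p - q) / sqrt 2 ^ n"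
    by (induction n) (simp_all add: norm_shrink_diff)
  then have "norm (p - q) = sqrt 2 ^ n * norm ((shrink ^^ n) p - (shrink ^^ n) q)" by simp
  also have "\<dots> \<le> scaled_dist n p q"
    unfolding scaled_dist_def by (intro mult_left_mono norm_le_state_dist n) simp
  finally show ?thesis by (simp add: n)
qed

lemma plane_dist_four_point:
  "plane_dist i p q + plane_dist i r t \<le>
     max (plane_dist i p r + plane_dist i q t) (plane_dist i p t + plane_dist i q r)"
proof -
  have "finite {p, q, r, t}" by simp
  from plane_dist_code[OF this, of i] obtain n where
    n: "\<And>u v. u \<in> {p, q, r, t} \<Longrightarrow> v \<in> {p, q, r, t} \<Longrightarrow>
      plane_dist i u v = scaled_dist n u v"
    by metis
  show ?thesis
    using mult_left_mono[OF code_dist_four_point[of "code_of ((shrink ^^ n) p, False)" "code_of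
      ((shrink ^^ n) q, False)"
     "code_of ((shrink ^^ n) r, False)" "code_of ((shrink ^^ n) t, False)"], of "sqrt 2 ^ n"]
    by (simp add: n scaled_dist_def max_mult_distrib_left distrib_left)
qed

lemma plane_dist_quartet:
  assumes "plane_dist i p q + plane_dist i r t < plane_dist i p r + plane_dist i q t"
    and "plane_dist i p q + plane_dist i r t < plane_dist i p t + plane_dist i q r"
  shows "2 * plane_dist i p q + plane_dist i r t \<le> plane_dist i q r + plane_dist i q t \<or>
         2 * plane_dist i p q + plane_dist i r t \<le> plane_dist i p r + plane_dist i p t \<or>
         2 * plane_dist i r t + plane_dist i p q \<le> plane_dist i p t + plane_dist i q t \<or>
         2 * plane_dist i r t + plane_dist i p q \<le> plane_dist i p r + plane_dist i q r"
proof -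
  have "finite {p, q, r, t}" by simp
  from plane_dist_code[OF this, of i] obtain n where
    n: "\<And>u v. u \<in> {p, q, r, t} \<Longrightarrow> v \<in> {p, q, r, t} \<Longrightarrow>
      plane_dist i u v = scaled_dist n u v"
    by metis
  define D where "D u v = state_dist ((shrink ^^ n) u, False) ((shrink ^^ n) v, False)" for u v
  have e: "plane_dist i u v = sqrt 2 ^ n * D u v" if "u \<in> {p, q, r, t}" "v \<in> {p, q, r, t}"
    for u v
    using n[OF that] by (simp add: scaled_dist_def D_def)
  have l: "sqrt 2 ^ n * a + sqrt 2 ^ n * b < sqrt 2 ^ n * c + sqrt 2 ^ n * d \<longleftrightarrow>
    a + b < c + d"
    "2 * (sqrt 2 ^ n * a) + sqrt 2 ^ n * b \<le> sqrt 2 ^ n * c + sqrt 2 ^ n * d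
      \<longleftrightarrow> 2 * a + b \<le> c + d" for a b c d
  proof -
    have "2 * (sqrt 2 ^ n * a) + sqrt 2 ^ n * b = sqrt 2 ^ n * (2 * a + b)" by (simp add: algebra_simps)
    then show "sqrt 2 ^ n * a + sqrt 2 ^ n * b < sqrt 2 ^ n * c + sqrt 2 ^ n * d
      \<longleftrightarrow> a + b < c + d"
      "2 * (sqrt 2 ^ n * a) + sqrt 2 ^ n * b \<le> sqrt 2 ^ n * c + sqrt 2 ^ n * d
        \<longleftrightarrow> 2 * a + b \<le> c + d"
      unfolding distrib_left[symmetric] by simp_all
  qed
  from assms quartet_code[of "code_of ((shrink ^^ n) p, False)" "code_of ((shrink ^^ n) q, False)"
     "code_of ((shrink ^^ n) r, False)" "code_of ((shrink ^^ n) t, False)", folded D_def]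
  show ?thesis by (simp add: e l)
qed

text \<open>If the first different turn has an odd index, one more \<open>shrink\<close> puts a
  common left turn in front and makes the index even; this is the metric of parity 1.\<close>

lemma plane_dist_stretch:
  assumes "p \<noteq> q"
  obtains i where "i < 2" "plane_dist i p q \<le> sqrt 26 * norm (p - q)"
proof -
  obtain k where k: "\<forall>v\<in>{p, q}. \<forall>n\<ge>k. (shrink ^^ n) v \<in> triangle"
    using common_triangle[of "{p, q}"] by blast
  let ?z = "(shrink ^^ (2 * k)) p" and ?w = "(shrink ^^ (2 * k)) q"
  have norm_eq: "norm ((shrink ^^ n) p - (shrink ^^ n) q) = norm (p - q) / sqrt 2 ^ n" for n
    by (induction n) (simp_all add: norm_shrink_diff)
  have tri: "?z \<in> triangle" "?w \<in> triangle" "shrink ?z \<in> triangle" "shrink ?w \<in> triangle"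
    using k by (auto intro: shrink_triangle)
  have "?z \<noteq> ?w" using norm_eq[of "2 * k"] assms by auto
  then obtain n where n: "turn n ?z \<noteq> turn n ?w" "\<forall>m<n. turn m ?z = turn m ?w"
    using turn_separates[OF tri(1,2)] by blast
  show ?thesis
  proof (cases "even n")
    case True
    then have "state_dist (?z, False) (?w, False) \<le> sqrt 26 * norm (?z - ?w)"
      using n by (intro state_dist_le_norm[where k = "n div 2"] tri) auto
    then have "scaled_dist (2 * k) p q \<le> sqrt 26 * norm (p - q)"
      unfolding norm_eq scaled_dist_def by (simp add: field_simps)
    then show ?thesis
      using plane_dist_eq[of 0 k p q] tri by (intro that[of 0]) simp_all
  next
    case False
    then have "state_dist (shrink ?z, False) (shrink ?w, False) \<le> sqrt 26 * norm (shrink ?z -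
      shrink ?w)"
      using n tri
      by (intro state_dist_le_norm[where k = "Suc n div 2"] tri)
        (auto simp: turn_Suc zoom_shrink turn_0 not_right_shrink less_Suc_eq_0_disj)
    then have "scaled_dist (1 + 2 * k) p q \<le> sqrt 26 * norm (p - q)"
      unfolding norm_shrink_diff norm_eq scaled_dist_def by (simp add: field_simps)
    then show ?thesis
      using plane_dist_eq[of 1 k p q] tri by (intro that[of 1]) simp_all
  qed
qed

subsection \<open>Minimum spanning trees of tree metrics\<close>

locale hop_metric =
  fixes d :: "'a::metric_space \<Rightarrow> 'a \<Rightarrow> real" and key :: "'a \<Rightarrow> real"
  assumes refl [simp]: "d x x = 0"
    and commute: "d x y = d y x"
    and dist_le: "dist x y \<le> d x y"
    and four_point: "d p q + d r t \<le> max (d p r + d q t) (d p t + d q r)"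
    and quartet: "d p q + d r t < d p r + d q t \<Longrightarrow> d p q + d r t < d p t + d q r
      \<Longrightarrow>
         2 * d p q + d r t \<le> d q r + d q t \<or> 2 * d p q + d r t \<le> d p r + d p t \<or>
         2 * d r t + d p q \<le> d p t + d q t \<or> 2 * d r t + d p q \<le> d p r + d q r"
    and inj_key: "inj key"
begin

lemma d_pos: "x \<noteq> y \<Longrightarrow> 0 < d x y"
  using dist_le[of x y] by (smt (verit) zero_less_dist_iff)

definition closer :: "'a \<Rightarrow> 'a \<Rightarrow> 'a \<Rightarrow> bool" where
  "closer x y z \<longleftrightarrow> d x y < d x z \<or> d x y = d x z \<and> key y < key z"

lemma closer_le: "closer x y z \<Longrightarrow> d x y \<le> d x z"
  by (auto simp: closer_def)

lemma closer_key: "closer x y z \<Longrightarrow> d x y = d x z \<Longrightarrow> key y < key z"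
  by (auto simp: closer_def)

lemma closer_irrefl [simp]: "\<not> closer x y y"
  by (simp add: closer_def)

lemma closer_trans: "closer x y z \<Longrightarrow> closer x z w \<Longrightarrow> closer x y w"
  unfolding closer_def by linarith

lemma closer_asym: "closer x y z \<Longrightarrow> \<not> closer x z y"
  unfolding closer_def by linarith

lemma closer_linear: "y \<noteq> z \<Longrightarrow> closer x y z \<or> closer x z y"
  using inj_key unfolding closer_def inj_def by (metis linorder_neqE_linordered_idom)

lemma closer_self: "y \<noteq> x \<Longrightarrow> closer x x y"
  using d_pos[of x y] by (simp add: closer_def)

lemma not_closer_self: "\<not> closer x y x"
  by (metis closer_asym closer_irrefl closer_self)

lemma finite_closer_min:
  assumes "finite S" "S \<noteq> {}"
  obtains m where "m \<in> S" "\<And>y. y \<in> S \<Longrightarrow> y \<noteq> m \<Longrightarrow>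
    closer x m y"
  using assms
proof (induction S arbitrary: thesis rule: finite_ne_induct)
  case (insert y S)
  from insert.IH obtain m where m: "m \<in> S" "\<And>z. z \<in> S \<Longrightarrow> z \<noteq> m
    \<Longrightarrow> closer x m z" by blast
  with closer_linear[of y m x] insert.hyps consider "closer x y m" | "closer x m y" by blast
  then show ?case
    by cases (use m insert.prems closer_trans in blast)+
qed simp

lemma finite_closer_max:
  assumes "finite S" "S \<noteq> {}"
  obtains m where "m \<in> S" "\<And>y. y \<in> S \<Longrightarrow> y \<noteq> m \<Longrightarrow>
    closer x y m"
  using assms
proof (induction S arbitrary: thesis rule: finite_ne_induct)
  case (insert y S)
  from insert.IH obtain m where m: "m \<in> S" "\<And>z. z \<in> S \<Longrightarrow> z \<noteq> m
    \<Longrightarrow> closer x z m" by blast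
  with closer_linear[of y m x] insert.hyps consider "closer x y m" | "closer x m y" by blast
  then show ?case
    by cases (use m insert.prems closer_trans in blast)+
qed simp

section \<open>Next hops in the relative neighborhood graph\<close>

text \<open>The relative neighborhood graph, with ties broken by the keys; in a tree metric it is the
  minimum spanning tree.\<close>

definition adj :: "'a set \<Rightarrow> 'a \<Rightarrow> 'a \<Rightarrow> bool" where
  "adj P p q \<longleftrightarrow> p \<in> P \<and> q \<in> P \<and> p \<noteq> q \<and>
    (\<forall>r\<in>P - {p, q}. closer p q r \<or> closer q p r)"

definition edges :: "'a set \<Rightarrow> 'a set set" where
  "edges P = {{p, q} | p q. adj P p q}"

lemma adj_commute: "adj P p q \<longleftrightarrow> adj P q p"
  unfolding adj_def by (auto simp: insert_commute)

lemma edges_iff: "{p, q} \<in> edges P \<longleftrightarrow> adj P p q"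
  unfolding edges_def using adj_commute by (auto simp: doubleton_eq_iff)

lemma adjD:
  assumes "adj P p q" shows "p \<in> P" "q \<in> P" "p \<noteq> q"
    "\<And>r. r \<in> P \<Longrightarrow> r \<noteq> p \<Longrightarrow> r \<noteq> q
      \<Longrightarrow> closer p q r \<or> closer q p r"
  using assms by (auto simp: adj_def)

text \<open>Take for \<open>c\<close> the point nearest to \<open>a\<close> among those closer to
  \<open>b\<close>. A point \<open>r\<close> that blocks the edge is closer to \<open>a\<close>,
  hence farther from \<open>b\<close> than \<open>a\<close>. The four-point condition then leaves
  only ties, whose keys would increase around a cycle.\<close>

lemma ex_closer_adj:
  assumes "finite P" "a \<in> P" "b \<in> P" "a \<noteq> b"
  obtains c where "adj P a c" "closer b c a"
proof -
  let ?X = "{x \<in> P. closer b x a}"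
  have "b \<in> ?X" using assms by (auto intro: closer_self)
  then have "finite ?X" "?X \<noteq> {}" using assms(1) by auto
  then obtain c where c: "c \<in> ?X" "\<And>y. y \<in> ?X \<Longrightarrow> y \<noteq> c
    \<Longrightarrow> closer a c y"
    by (rule finite_closer_min[where x = a]) blast
  have "adj P a c"
    unfolding adj_def
  proof (intro conjI ballI)
    show "a \<noteq> c" using c by auto
    fix r assume r: "r \<in> P - {a, c}"
    show "closer a c r \<or> closer c a r"
    proof (rule ccontr)
      assume "\<not> (closer a c r \<or> closer c a r)"
      with r closer_linear have n: "closer a r c" "closer c r a" by auto
      then have "r \<notin> ?X" using c(2)[of r] r closer_asym by blast
      with r have b: "closer b a r" using closer_linear[of a r b] by auto
      have bc: "closer b c a" using c by simp
      have le: "d a r \<le> d a c" "d c r \<le> d a c" "d a b \<le> d b r" "d b c \<le> d a b"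
        using n[THEN closer_le] b[THEN closer_le] bc[THEN closer_le] by (simp_all add: commute)
      have "d a c + d b r \<le> d a b + d c r \<or> d a c + d b r \<le> d a r + d b c"
        using four_point[of a c b r] by (simp add: commute le_max_iff_disj)
      then consider "d c r = d c a" "d b a = d b r" | "d a r = d a c" "d b c = d b a" "d b a = d b r"
        using le commute[of a b] commute[of a c] by fastforce
      then show False
      proof cases
        case 1
        then show False using closer_key[OF n(2)] closer_key[OF b] by simp
      next
        case 2
        then show False using closer_key[OF n(1)] closer_key[OF bc] closer_key[OF b] by simp
      qed
    qed
  qed (use assms c in auto)
  with c show ?thesis by (auto intro: that)
qed

text \<open>The nearer of two such neighbors does not block the edge to the other, so they are on
  different sides of \<open>a\<close>. The four-point condition for \<open>a\<close>,
  \<open>b\<close>, \<open>c\<close>, \<open>c'\<close> again leaves only ties with contradictory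
  keys.\<close>

lemma closer_adj_unique:
  assumes "adj P a c" "closer b c a" "adj P a c'" "closer b c' a"
  shows "c = c'"
proof -
  have False if "adj P a c" "closer b c a" "adj P a c'" "closer b c' a" "closer a c' c" for c c'
  proof -
    have "c \<noteq> c'" using that by auto
    then have n: "closer c a c'"
      using adjD(4)[OF that(1), of c'] adjD[OF that(3)] that(5) closer_asym by blast
    have le: "d a c' \<le> d a c" "d a c \<le> d c c'" "d b c \<le> d a b" "d b c' \<le> d a b"
      using that(2,4,5)[THEN closer_le] n[THEN closer_le] by (simp_all add: commute)
    have "d c c' + d a b \<le> d a c + d b c' \<or> d c c' + d a b \<le> d a c' + d b c"
      using four_point[of c c' a b] commute[of c a] commute[of c b] commute[of c' a] commute[of c' b]
      by (auto simp: le_max_iff_disj)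
    then consider "d c a = d c c'" "d b c' = d b a" | "d a c' = d a c" "d c a = d c c'" "d b c = d b a"
      using le commute[of a b] commute[of a c] by fastforce
    then show False
    proof cases
      case 1
      then show False using closer_key[OF n] closer_key[OF that(4)] by simp
    next
      case 2
      then show False using closer_key[OF n] closer_key[OF that(5)] closer_key[OF that(2)] by simp
    qed
  qed
  with assms closer_linear[of c c' a] show ?thesis by blast
qed

text \<open>
  Let \<open>x\<close> and \<open>x'\<close> be the points where \<open>c\<close> and \<open>c'\<close> are attached to the path to \<open>b\<close>, and \<open>h\<close>, \<open>h'\<close>
  their distances to that path. The claim is \<open>dist c c' \<le> 4 * s\<close> for \<open>s = d x x'\<close>. It follows from
  \<open>\<bar>h - h'\<bar> \<le> s\<close> and \<open>min h h' \<le> s\<close>; the latter holds as \<open>a\<close> and \<open>b\<close> are no closer to \<open>x\<close> and \<open>x'\<close>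
  than \<open>c\<close> and \<open>c'\<close>.
\<close>

lemma step_cost:
  assumes "b \<in> P" "adj P a c" "closer b c a" "c \<noteq> b" "adj P c c'" "closer b c' c"
  shows "dist c c' + 2 * (d c' b + d c b - d c c') \<le> 2 * (d c b + d a b - d a c)"
proof -
  note cP = adjD[OF assms(2)] adjD[OF assms(5)]
  have "closer b c' a" using assms(3,6) closer_trans by blast
  then have "c' \<noteq> a" "a \<noteq> b" using assms(3) not_closer_self by auto
  have le: "d c b \<le> d a b" "d c' b \<le> d c b"
    using assms(3,6)[THEN closer_le] by (simp_all add: commute)
  have ac: "closer a c c' \<or> closer c a c'"
    using adjD(4)[OF assms(2), of c'] cP \<open>c' \<noteq> a\<close> by auto
  have "dist c c' \<le> d c c'" by (rule dist_le)
  show ?thesis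
  proof (cases "c' = b")
    case True
    have "closer a c b \<or> closer c a b" 
      using adjD(4)[OF assms(2), of b] assms(1,4) \<open>a \<noteq> b\<close> by auto
    then have "d a c \<le> d a b" using le closer_le[of a c b] closer_le[of c a b] by (auto simp:
      commute)
    with True \<open>dist c c' \<le> d c c'\<close> le show ?thesis by simp
  next
    case False
    have cb: "d c c' \<le> d c b"
      using adjD(4)[OF assms(5), of b] assms(1,4) False le closer_le[of c c' b] closer_le[of c' c b]
      by (auto simp: commute)
    let ?S1 = "d a c + d c' b" and ?S2 = "d a c' + d c b" and ?S3 = "d a b + d c c'"
    have S: "?S1 < ?S2 \<or> ?S1 < ?S3"
      using ac
    proof
      assume acc: "closer a c c'"
      have "?S1 \<noteq> ?S2"
      proof
        assume "?S1 = ?S2"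
        with le closer_le[OF acc] have "d a c = d a c'" "d b c' = d b c" by (simp_all add: commute)
        with closer_key[OF acc] closer_key[OF assms(6)] show False by simp
      qed
      with le closer_le[OF acc] show ?thesis by linarith
    next
      assume cac: "closer c a c'"
      have "?S1 \<noteq> ?S3"
      proof
        assume "?S1 = ?S3"
        with le closer_le[OF cac] have "d c a = d c c'" "d b c' = d b a" by (simp_all add: commute)
        with closer_key[OF cac] closer_key[OF \<open>closer b c' a\<close>] show False by simp
      qed
      with le closer_le[OF cac] show ?thesis using commute[of a c] by linarith
    qed
    have f: "?S2 \<le> ?S1 \<or> ?S2 \<le> ?S3" "?S3 \<le> ?S1 \<or> ?S3 \<le> ?S2"
      using four_point[of a c' c b] four_point[of a b c c'] by (simp_all add: commute le_max_iff_disj)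
    \<comment> \<open>The two largest sums agree, so \<open>?S1\<close> is the strict minimum: the
      inner edge from \<open>x\<close> to \<open>x'\<close> separates \<open>a\<close>,
      \<open>c\<close> from \<open>c'\<close>, \<open>b\<close>.\<close>
    with S have eq: "?S2 = ?S3" "?S1 < ?S2" by linarith+
    \<comment> \<open>The short pendant edge may also be that of \<open>a\<close> or of
      \<open>b\<close>. Because of \<open>d c b \<le> d a b\<close> and
      \<open>d c c' \<le> d c b\<close>, the one of \<open>c\<close> or \<open>c'\<close> is then no
      longer.\<close>
    have q: "2 * d a c + d c' b \<le> d c c' + d c b \<or> 2 * d a c + d c' b \<le> d a c' + d a b \<or>
         2 * d c' b + d a c \<le> d a b + d c b \<or> 2 * d c' b + d a c \<le> d a c' + d c c'"
      using quartet[of a c c' b] eq by simp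
    have "d a c \<le> d a c' \<or> d a c \<le> d c c'"
      using ac closer_le[of a c c'] closer_le[of c a c'] by (auto simp: commute)
    with q eq le cb \<open>dist c c' \<le> d c c'\<close> show ?thesis by argo
  qed
qed

text \<open>Both neighbors on the path would be closer to \<open>b\<close>, against
  \<open>closer_adj_unique\<close>.\<close>

lemma interior_not_farthest:
  assumes E: "successively (\<lambda>x y. {x, y} \<in> edges P) xs" and "distinct xs"
    and "0 < i" "Suc i < length xs" "\<And>y. y \<in> set xs \<Longrightarrow> y \<noteq> xs ! i
      \<Longrightarrow> closer b y (xs ! i)"
  shows False
proof -
  have n: "adj P (xs ! i) (xs ! (i - 1))" "adj P (xs ! i) (xs ! Suc i)"
    using E assms(3,4) adj_commute unfolding successively_conv_nth edges_iff
    by (metis Suc_diff_1 Suc_lessD, blast)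
  have "closer b (xs ! (i - 1)) (xs ! i)" "closer b (xs ! Suc i) (xs ! i)"
    using assms by (auto simp: nth_eq_iff_index_eq)
  from closer_adj_unique[OF n(1) this(1) n(2) this(2)] show False
    using assms by (simp add: nth_eq_iff_index_eq)
qed

section \<open>Tree structure: connectedness, acyclicity, parents and number of edges\<close>

lemma ex_closer_walk:
  assumes "finite P" "a \<in> P" "b \<in> P"
  shows "\<exists>xs. walk (edges P) a (a # xs) b \<and> distinct (a # xs) \<and>
    (\<forall>x\<in>set xs. closer b x a)"
  using assms(2)
proof (induction "card {x \<in> P. closer b x a}" arbitrary: a rule: less_induct)
  case less
  show ?case
  proof (cases "a = b")
    case True
    then show ?thesis by (intro exI[of _ "[]"]) (simp add: walk_def)
  next
    case False
    obtain c where c: "adj P a c" "closer b c a"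
      using ex_closer_adj[OF assms(1) less.prems assms(3) False] .
    have "{x \<in> P. closer b x c} \<subset> {x \<in> P. closer b x a}"
    proof (rule psubsetI)
      have "c \<in> {x \<in> P. closer b x a}" "c \<notin> {x \<in> P. closer b x c}"
        using c adjD(2)[OF c(1)] by simp_all
      then show "{x \<in> P. closer b x c} \<noteq> {x \<in> P. closer b x a}" by metis
      show "{x \<in> P. closer b x c} \<subseteq> {x \<in> P. closer b x a}"
        using c(2) closer_trans by blast
    qed
    then have "card {x \<in> P. closer b x c} < card {x \<in> P. closer b x a}"
      using assms(1) by (intro psubset_card_mono) auto
    from less.hyps[OF this adjD(2)[OF c(1)]] obtain xs where
      xs: "walk (edges P) c (c # xs) b" "distinct (c # xs)" "\<forall>x\<in>set xs. closer b x c"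
        by blast
    show ?thesis
    proof (intro exI[of _ "c # xs"] conjI)
      show "walk (edges P) a (a # c # xs) b"
        using xs(1) c(1) by (simp add: walk_def edges_iff)
      show "\<forall>x\<in>set (c # xs). closer b x a"
        using xs(3) c(2) closer_trans by auto
      then show "distinct (a # c # xs)"
        using xs(2) by auto
    qed
  qed
qed

lemma no_cycle: "\<not> cycle (edges P) xs"
proof
  assume cyc: "cycle (edges P) xs"
  then have xs: "length xs \<ge> 3" "distinct xs" "successively (\<lambda>x y. {x, y} \<in> edges P) xs"
    "{last xs, hd xs} \<in> edges P" by (auto simp: cycle_def)
  then have ne: "xs \<noteq> []" by auto
  txt \<open>Measure distances from the second vertex, so that the farthest vertex is another one.\<close>
  define b where "b = xs ! 1"
  obtain m where m: "m \<in> set xs" "\<And>y. y \<in> set xs \<Longrightarrow> y \<noteq> m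
    \<Longrightarrow> closer b y m"
    using finite_closer_max[of "set xs" b] ne by auto
  then obtain i where i: "i < length xs" "m = xs ! i" by (auto simp: in_set_conv_nth)
  have closer_nth: "closer b (xs ! j) (xs ! i)" if "j < length xs" "j \<noteq> i" for j
    using m(2)[of "xs ! j"] that i xs(2) by (auto simp: nth_eq_iff_index_eq)
  have adj_last: "adj P (xs ! (length xs - 1)) (xs ! 0)"
    using xs(4) ne by (simp add: edges_iff last_conv_nth hd_conv_nth)
  have adj_Suc: "adj P (xs ! j) (xs ! Suc j)" if "Suc j < length xs" for j
    using xs(3) that by (auto simp: successively_conv_nth edges_iff)
  consider "i = 0" | "i = length xs - 1" | "0 < i" "Suc i < length xs" using i by linarith
  then show False
  proof cases
    case 1
    have "xs ! (length xs - 1) = xs ! 1"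
      using closer_adj_unique[of P "xs ! 0" _ b] adj_last adj_Suc[of 0] closer_nth[of 1]
        closer_nth[of "length xs - 1"] xs(1) 1 by (auto simp: adj_commute)
    then show False using xs(1,2) by (auto simp: nth_eq_iff_index_eq)
  next
    case 2
    have "adj P (xs ! i) (xs ! (i - 1))"
      using adj_Suc[of "i - 1"] 2 xs(1) adj_commute by (simp add: numeral_2_eq_2 Suc_diff_Suc)
    moreover have "closer b (xs ! 0) (xs ! i)" "closer b (xs ! (i - 1)) (xs ! i)"
      using 2 i xs(1) by (intro closer_nth; linarith)+
    ultimately have "xs ! 0 = xs ! (i - 1)"
      using closer_adj_unique[of P "xs ! i" "xs ! 0" b "xs ! (i - 1)"] adj_last 2 by simp
    then show False using nth_eq_iff_index_eq[OF xs(2), of 0 "i - 1"] xs(1) ne 2 by auto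
  next
    case 3
    from interior_not_farthest[OF xs(3,2) this] m(2) i(2) show False by auto
  qed
qed

lemma spanning_tree_edges:
  assumes "finite P" shows "spanning_tree P (edges P)"
  unfolding spanning_tree_def
proof (intro conjI ballI)
  show "graph_on P (edges P)"
    unfolding graph_on_def edges_def adj_def by blast
  show "\<exists>xs. walk (edges P) u xs v" if "u \<in> P" "v \<in> P" for u v
    using ex_closer_walk[OF assms that] by blast
  show "\<nexists>xs. cycle (edges P) xs" using no_cycle by blast
qed

text \<open>The vertex of the path farthest from \<open>r\<close> is neither interior nor
  \<open>r\<close> itself, hence it is the first one. This identifies the parent with the next hop
  towards the root.\<close>

lemma second_vertex_closer:
  assumes w: "walk (edges P) v (v # u # xs) r" and dis: "distinct (v # u # xs)"
  shows "adj P v u \<and> closer r u v"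
proof -
  let ?ys = "v # u # xs"
  obtain m where m: "m \<in> set ?ys" "\<And>y. y \<in> set ?ys \<Longrightarrow> y \<noteq> m
    \<Longrightarrow> closer r y m"
    using finite_closer_max[of "set ?ys" r] by auto
  then obtain i where i: "i < length ?ys" "m = ?ys ! i" by (metis in_set_conv_nth)
  have r: "r = ?ys ! (length ?ys - 1)" using w last_conv_nth[of ?ys] by (simp add: walk_def)
  have succ: "successively (\<lambda>x y. {x, y} \<in> edges P) ?ys" using w by (simp add: walk_def)
  have "i = 0"
  proof (rule ccontr)
    assume "i \<noteq> 0"
    then have "v \<noteq> m" using dis i by (auto simp: nth_eq_iff_index_eq nth_Cons')
    then have "closer r v m" using m(2) by simp
    then have "i \<noteq> length ?ys - 1" using r i not_closer_self by auto
    with i have "Suc i < length ?ys" by auto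
    from interior_not_farthest[OF succ dis _ this, of r] \<open>i \<noteq> 0\<close> m i show False
      by auto
  qed
  then have "closer r u v" using m(2)[of u] i dis by auto
  moreover have "adj P v u" using succ by (simp add: edges_iff)
  ultimately show ?thesis by blast
qed

lemma parent_edges:
  assumes "finite P" "v \<in> P" "r \<in> P" "v \<noteq> r"
  obtains u where "parent (edges P) r v = Some u" "adj P v u"
proof -
  obtain xs where xs: "walk (edges P) v (v # xs) r" "distinct (v # xs)"
    using ex_closer_walk[OF assms(1-3)] by blast
  with assms(4) obtain u ys where u: "xs = u # ys" by (cases xs) (auto simp: walk_def)
  have "parent (edges P) r v = Some u"
    unfolding parent_def using assms(4) xs u second_vertex_closer closer_adj_unique
    by (auto intro!: the_equality) blast
  with second_vertex_closer[of P v u ys r] xs u show ?thesis by (intro that) auto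
qed

text \<open>Every edge joins its end farther from \<open>r\<close> to the unique closer neighbor of
  that end, and \<open>r\<close> is never the farther end.\<close>

lemma card_edges:
  assumes "finite P" "P \<noteq> {}" shows "card (edges P) \<le> card P - 1"
proof -
  obtain r where r: "r \<in> P" using assms by blast
  define f where "f v = {v, SOME c. adj P v c \<and> closer r c v}" for v
  have "edges P \<subseteq> f ` (P - {r})"
  proof
    fix e assume "e \<in> edges P"
    then obtain p q where e: "e = {p, q}" "adj P p q" by (auto simp: edges_def)
    have *: "{p, q} \<in> f ` (P - {r})" if "adj P p q" "closer r q p" for p q
    proof
      have "(SOME c. adj P p c \<and> closer r c p) = q"
        using that closer_adj_unique by (metis (mono_tags, lifting) someI_ex)
      then show "{p, q} = f p" by (simp add: f_def)
      show "p \<in> P - {r}" using that adjD not_closer_self by blast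
    qed
    show "e \<in> f ` (P - {r})"
      using *[of p q] *[of q p] e adj_commute adjD(3)[OF e(2)] closer_linear[of p q r]
      by (metis insert_commute)
  qed
  then have "card (edges P) \<le> card (P - {r})"
    using assms(1) surj_card_le[of "P - {r}"] by blast
  with r show ?thesis by simp
qed

end

subsection \<open>Routing\<close>

definition to_complex :: "point \<Rightarrow> complex" where
  "to_complex p = Complex (p $ 1) (p $ 2)"

lemma dist_to_complex: "norm (to_complex p - to_complex q) = dist p q"
  by (simp add: to_complex_def cmod_def dist_vec_def L2_set_def sum_2 dist_real_def)

text \<open>The algorithm has to break ties without knowing \<open>P\<close>, so the key is one
  injection of the whole plane; the plane and the line are equinumerous.\<close>

lemma ex_inj_key: "\<exists>f :: point \<Rightarrow> real. inj f"
proof -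
  have "\<exists>g. bij_betw g (UNIV \<times> UNIV :: (real \<times> real) set) (UNIV :: real set)"
    unfolding card_of_ordIso by (rule card_of_Times_same_infinite) (rule infinite_UNIV_char_0)
  then obtain g :: "real \<times> real \<Rightarrow> real" where "bij g" by auto
  have "inj (\<lambda>p :: point. g (p $ 1, p $ 2))"
  proof (rule injI)
    fix p q :: point
    assume "g (p $ 1, p $ 2) = g (q $ 1, q $ 2)"
    then have "(p $ 1, p $ 2) = (q $ 1, q $ 2)" using bij_is_inj[OF \<open>bij g\<close>] by (rule
      injD[rotated])
    then show "p = q" by (simp add: vec_eq_iff forall_2)
  qed
  then show ?thesis by (intro exI[of _ "\<lambda>p. g (p $ 1, p $ 2)"])
qed

definition key :: "point \<Rightarrow> real" where
  "key = (SOME f. inj f)"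

definition tree_dist :: "nat \<Rightarrow> point \<Rightarrow> point \<Rightarrow> real" where
  "tree_dist i p q = plane_dist i (to_complex p) (to_complex q)"

interpretation hop: hop_metric "tree_dist i" key for i
proof
  show "inj key" unfolding key_def by (rule someI_ex[OF ex_inj_key])
  show "dist x y \<le> tree_dist i x y" for x y
    using norm_le_plane_dist[of "to_complex x" "to_complex y" i] by (simp add: tree_dist_def
      dist_to_complex)
qed (auto simp: tree_dist_def plane_dist_refl plane_dist_commute
      intro: plane_dist_four_point dest: plane_dist_quartet)

definition members :: "neighbor_list \<Rightarrow> point set" where
  "members N = set_option (fst N) \<union> snd N"

definition hop_in :: "nat \<Rightarrow> neighbor_list \<Rightarrow> point \<Rightarrow> point
  \<Rightarrow> point" where
  "hop_in i N b a = (THE c. c \<in> members N \<and> hop.closer i b c a)"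

text \<open>
  An upper bound for the length of the walk from \<open>a\<close> to \<open>b\<close> in tree \<open>i\<close> that starts with the hop
  to \<open>c\<close>: four times the distance to \<open>b\<close> of the point where the path of the underlying tree metric
  from \<open>c\<close> joins the one from \<open>a\<close>, plus the first hop.
\<close>

definition cost_bound :: "nat \<Rightarrow> point \<Rightarrow> point \<Rightarrow> point
  \<Rightarrow> real" where
  "cost_bound i b a c = dist a c + 2 * (tree_dist i c b + tree_dist i a b - tree_dist i a c)"

definition two_tree_routing :: local_algorithm where
  "two_tree_routing a b N1 N2 =
     (let c1 = hop_in 0 N1 b a; c2 = hop_in 1 N2 b a
      in if cost_bound 0 b a c1 \<le> cost_bound 1 b a c2 then c1 else c2)"

lemma members_neighbor_list:
  assumes "finite P" "v \<in> P" "r \<in> P"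
  shows "members (neighbor_list (hop.edges i P) r v) = {c. hop.adj i P v c}"
proof (cases "v = r")
  case True
  then show ?thesis
    by (auto simp: members_def neighbor_list_def parent_def neighbors_def hop.edges_iff)
next
  case False
  obtain u where u: "parent (hop.edges i P) r v = Some u" "hop.adj i P v u"
    using hop.parent_edges[OF assms False] .
  then show ?thesis
    by (auto simp: members_def neighbor_list_def neighbors_def hop.edges_iff)
qed

lemma hop_in_adj:
  fixes i :: nat
  assumes "finite P" "a \<in> P" "b \<in> P" "a \<noteq> b" "r \<in> P"
  defines "c \<equiv> hop_in i (neighbor_list (hop.edges i P) r a) b a"
  shows "hop.adj i P a c" "hop.closer i b c a"
proof -
  obtain c' where c': "hop.adj i P a c'" "hop.closer i b c' a"
    using hop.ex_closer_adj[OF assms(1-4)] .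
  then have "c = c'"
    unfolding c_def hop_in_def members_neighbor_list[OF assms(1,2,5)]
    using hop.closer_adj_unique by (intro the_equality) auto
  with c' show "hop.adj i P a c" "hop.closer i b c a" by auto
qed

text \<open>The term \<open>- 2 * tree_dist i a c\<close> absorbs the first hop, and
  \<open>c\<close> is no farther from \<open>b\<close> than \<open>a\<close> is. This is the factor
  4 of the routing ratio.\<close>

lemma cost_bound_le: "hop.closer i b c a \<Longrightarrow> cost_bound i b a c \<le> 4 * tree_dist i a b"
  using hop.closer_le[of i b c a] hop.dist_le[of a c i] zero_le_dist[of a c]
  unfolding cost_bound_def hop.commute[of i b] by argo

lemma traverses_hd: "traverses A T1 r1 T2 r2 b a p \<Longrightarrow> \<exists>q. p = a # q"
  by (induction rule: traverses.induct) auto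

text \<open>\<open>bound\<close> is a potential that drops by at least the length of every hop, so
  its initial value bounds the whole path. Hops have positive length and \<open>P\<close> is finite,
  so the query arrives.\<close>

lemma two_tree_routing_traverses:
  fixes P :: "point set"
  assumes "finite P" "r \<in> P" "b \<in> P" "a \<in> P"
  defines "T \<equiv> \<lambda>i. hop.edges i P"
  defines "h \<equiv> \<lambda>i a. hop_in i (neighbor_list (T i) r a) b a"
  defines "bound \<equiv> \<lambda>a. if a = b then 0 else min (cost_bound 0 b a (h 0 a))
    (cost_bound 1 b a (h 1 a))"
  shows "\<exists>p. traverses two_tree_routing (T 0) r (T 1) r b a p \<and> path_length p \<le> bound a"
  using assms(4)
proof (induction "card {x \<in> P. bound x < bound a}" arbitrary: a rule: less_induct)
  case less
  show ?case
  proof (cases "a = b")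
    case True
    then show ?thesis
      by (intro exI[of _ "[b]"]) (simp add: traverses.arrived path_length_def bound_def)
  next
    case False
    define i :: nat where "i = (if cost_bound 0 b a (h 0 a) \<le> cost_bound 1 b a (h 1 a) then 0
      else 1)"
    define c where "c = h i a"
    have c: "hop.adj i P a c" "hop.closer i b c a"
      using hop_in_adj[OF assms(1) less.prems assms(3) False assms(2), of i]
      unfolding c_def h_def T_def by blast+
    have next_c: "next_hop two_tree_routing (T 0) r (T 1) r b a = c"
      by (simp add: next_hop_def two_tree_routing_def Let_def c_def h_def i_def)
    have ab: "bound a = cost_bound i b a c"
      using False by (simp add: bound_def i_def c_def min_def)
    have cP: "c \<in> P" and ac: "a \<noteq> c" using hop.adjD[OF c(1)] by blast+
    \<comment> \<open>Staying in tree \<open>i\<close> would already achieve the decrease, by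
      \<open>step_cost\<close>; the minimum over both trees is no larger.\<close>
    have step: "bound c \<le> bound a - dist a c"
    proof (cases "c = b")
      case True
      then show ?thesis unfolding ab by (simp add: bound_def cost_bound_def)
    next
      case cb: False
      have c': "hop.adj i P c (h i c)" "hop.closer i b (h i c) c"
        using hop_in_adj[OF assms(1) cP assms(3) cb assms(2), of i] unfolding h_def T_def by blast+
      have "bound c \<le> cost_bound i b c (h i c)"
        using cb by (simp add: bound_def i_def min_def)
      also have "\<dots> \<le> cost_bound i b a c - dist a c"
        using hop.step_cost[OF assms(3) c cb c'] by (simp add: cost_bound_def)
      finally show ?thesis unfolding ab .
    qed
    have "bound c < bound a" using step ac zero_less_dist_iff[of a c] by linarith
    then have "card {x \<in> P. bound x < bound c} < card {x \<in> P. bound x < bound a}"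
      using assms(1) cP by (intro psubset_card_mono) auto
    from less.hyps[OF this cP] obtain p where
      p: "traverses two_tree_routing (T 0) r (T 1) r b c p" "path_length p \<le> bound c" by blast
    obtain q where q: "p = c # q" using traverses_hd[OF p(1)] by blast
    have "c \<in> neighbors (T 0 \<union> T 1) a"
      using c(1) by (auto simp: neighbors_def T_def i_def hop.edges_iff split: if_splits)
    then have "traverses two_tree_routing (T 0) r (T 1) r b a (a # p)"
      using False next_c p(1) by (intro traverses.hop[of a b c]) auto
    moreover have "path_length (a # p) \<le> bound a"
      using p(2) step by (simp add: path_length_def q)
    ultimately show ?thesis by blast
  qed
qed

theorem theorem3p3:
  shows "\<exists>A :: local_algorithm. \<forall>P :: point set. finite P \<and> P \<noteq> {}
    \<longrightarrow>
    (\<exists>T1 r1 T2 r2.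
       spanning_tree P T1 \<and> r1 \<in> P \<and>
       spanning_tree P T2 \<and> r2 \<in> P \<and>
       card (T1 \<union> T2) \<le> 2 * card P - 2 \<and>
       achieves_routing_ratio A P T1 r1 T2 r2 (4 * sqrt 26))"
proof (intro exI[of _ two_tree_routing] allI impI)
  fix P :: "point set"
  assume P: "finite P \<and> P \<noteq> {}"
  then obtain r where r: "r \<in> P" by blast
  let ?T = "\<lambda>i. hop.edges i P"
  have "card (?T 0 \<union> ?T 1) \<le> card (?T 0) + card (?T 1)" by (rule card_Un_le)
  also have "\<dots> \<le> 2 * card P - 2"
    using hop.card_edges[of P 0] hop.card_edges[of P 1] P by simp
  finally have card: "card (?T 0 \<union> ?T 1) \<le> 2 * card P - 2" .
  have "achieves_routing_ratio two_tree_routing P (?T 0) r (?T 1) r (4 * sqrt 26)"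
    unfolding achieves_routing_ratio_def
  proof (intro ballI impI)
    fix a b assume ab: "a \<in> P" "b \<in> P" "a \<noteq> b"
    let ?h = "\<lambda>i. hop_in i (neighbor_list (?T i) r a) b a"
    obtain p where p: "traverses two_tree_routing (?T 0) r (?T 1) r b a p"
      "path_length p \<le> min (cost_bound 0 b a (?h 0)) (cost_bound 1 b a (?h 1))"
      using two_tree_routing_traverses[of P r b a] P r ab by auto
    have "to_complex a \<noteq> to_complex b" using dist_to_complex[of a b] ab(3) by auto
    then obtain i where i: "i < 2" "tree_dist i a b \<le> sqrt 26 * dist a b"
      using plane_dist_stretch[of "to_complex a" "to_complex b"] by (auto simp: tree_dist_def
        dist_to_complex)
    have "path_length p \<le> cost_bound i b a (?h i)"
      using p(2) i(1) by (auto simp: less_2_cases_iff)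
    also have "\<dots> \<le> 4 * tree_dist i a b"
      using P r ab by (intro cost_bound_le hop_in_adj(2)) auto
    also have "\<dots> \<le> 4 * sqrt 26 * dist a b" using i(2) by simp
    finally have "path_length p / dist a b \<le> 4 * sqrt 26"
      using ab(3) by (simp add: field_simps)
    with p(1) show "\<exists>p. traverses two_tree_routing (?T 0) r (?T 1) r b a p \<and>
      path_length p / dist a b \<le> 4 * sqrt 26"
      by blast
  qed
  with card r P show "\<exists>T1 r1 T2 r2.
       spanning_tree P T1 \<and> r1 \<in> P \<and> spanning_tree P T2 \<and> r2 \<in> P \<and>
       card (T1 \<union> T2) \<le> 2 * card P - 2 \<and>
       achieves_routing_ratio two_tree_routing P T1 r1 T2 r2 (4 * sqrt 26)"
    using hop.spanning_tree_edges[of P] by blast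
qed

end
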